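(* Let $\Bbbk$ be a field of characteristic $0$, let $\mathfrak{g}$ be a Lie algebra over $\Bbbk$ and let $\mathfrak{h} \subseteq \mathfrak{g}$ be a Lie subalgebra of finite codimension, i.e. $\dim_{\Bbbk}(\mathfrak{g}/\mathfrak{h}) < \infty$. Then $U(\mathfrak{h})$ is noetherian if and only if $U(\mathfrak{g})$ is noetherian.
   Context: $U(\mathfrak{g})$ denotes the universal enveloping algebra of $\mathfrak{g}$. Lie algebras may be infinite-dimensional. An associative $\Bbbk$-algebra is called noetherian if it is both left and right noetherian (for universal enveloping algebras, left noetherian and right noetherian are equivalent). *)

theory Defs
  imports Complex_Main "HOL-Library.Poly_Mapping" "HOL-Algebra.QuotRing"
begin

section \<open>Lie algebras and Lie subalgebras\<close>

text \<open>No dimension restriction is imposed: the type of elements is an arbitrary vector space.\<close>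

locale lie_algebra = vector_space scale
  for scale :: "'k::field \<Rightarrow> 'g::ab_group_add \<Rightarrow> 'g" +
  fixes bracket :: "'g \<Rightarrow> 'g \<Rightarrow> 'g"
  assumes bracket_add_left: "bracket (x + y) z = bracket x z + bracket y z"
    and bracket_add_right: "bracket x (y + z) = bracket x y + bracket x z"
    and bracket_scale_left: "bracket (scale c x) y = scale c (bracket x y)"
    and bracket_scale_right: "bracket x (scale c y) = scale c (bracket x y)"
    and bracket_self: "bracket x x = 0"
    and jacobi:
      "bracket x (bracket y z) + bracket y (bracket z x) + bracket z (bracket x y) = 0"

definition lie_subalgebra ::
    "('k::field \<Rightarrow> 'g::ab_group_add \<Rightarrow> 'g) \<Rightarrow> ('g \<Rightarrow> 'g \<Rightarrow> 'g) \<Rightarrow> 'g set \<Rightarrow> bool" where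
  "lie_subalgebra scale bracket L \<longleftrightarrow>
     module.subspace scale L \<and> (\<forall>x\<in>L. \<forall>y\<in>L. bracket x y \<in> L)"

lemma (in lie_algebra) lie_subalgebra_UNIV: "lie_subalgebra scale bracket UNIV"
  by (simp add: lie_subalgebra_def)


section \<open>Quotient spaces and finite codimension\<close>

definition coset :: "'g::ab_group_add set \<Rightarrow> 'g \<Rightarrow> 'g set" where
  "coset W x = {x + w | w. w \<in> W}"

definition quotient_space :: "'g::ab_group_add set \<Rightarrow> 'g set set" where
  "quotient_space W = range (coset W)"

definition quotient_add :: "'g::ab_group_add set \<Rightarrow> 'g set \<Rightarrow> 'g set" where
  "quotient_add A B = {a + b | a b. a \<in> A \<and> b \<in> B}"

text \<open>Adding \<open>W\<close> in the following definition only matters for \<open>c = 0\<close>,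
  where the plain dilation would collapse the coset to \<open>{0}\<close>.\<close>

definition quotient_scale ::
    "('k::field \<Rightarrow> 'g::ab_group_add \<Rightarrow> 'g) \<Rightarrow> 'g set \<Rightarrow> 'k \<Rightarrow> 'g set \<Rightarrow> 'g set" where
  "quotient_scale scale W c A = {scale c a + w | a w. a \<in> A \<and> w \<in> W}"

definition quotient_subspace ::
    "('k::field \<Rightarrow> 'g::ab_group_add \<Rightarrow> 'g) \<Rightarrow> 'g set \<Rightarrow> 'g set set \<Rightarrow> bool" where
  "quotient_subspace scale W T \<longleftrightarrow>
     T \<subseteq> quotient_space W \<and> coset W 0 \<in> T \<and>
     (\<forall>A\<in>T. \<forall>B\<in>T. quotient_add A B \<in> T) \<and>
     (\<forall>c. \<forall>A\<in>T. quotient_scale scale W c A \<in> T)"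

definition quotient_span ::
    "('k::field \<Rightarrow> 'g::ab_group_add \<Rightarrow> 'g) \<Rightarrow> 'g set \<Rightarrow> 'g set set \<Rightarrow> 'g set set" where
  "quotient_span scale W S = \<Inter>{T. quotient_subspace scale W T \<and> S \<subseteq> T}"

definition finite_codimension ::
    "('k::field \<Rightarrow> 'g::ab_group_add \<Rightarrow> 'g) \<Rightarrow> 'g set \<Rightarrow> bool" where
  "finite_codimension scale W \<longleftrightarrow>
     (\<exists>S \<subseteq> quotient_space W. finite S \<and> quotient_span scale W S = quotient_space W)"

context vector_space
begin

lemma quotient_add_coset:
  assumes "subspace W"
  shows "quotient_add (coset W x) (coset W y) = coset W (x + y)"
proof (intro equalityI subsetI)
  fix z assume "z \<in> quotient_add (coset W x) (coset W y)"
  then obtain v w where "v \<in> W" "w \<in> W" "z = (x + v) + (y + w)"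
    by (auto simp: quotient_add_def coset_def)
  then have "z = (x + y) + (v + w)" "v + w \<in> W"
    using assms by (auto simp: subspace_add algebra_simps)
  then show "z \<in> coset W (x + y)" by (auto simp: coset_def)
next
  fix z assume "z \<in> coset W (x + y)"
  then obtain w where "w \<in> W" "z = (x + 0) + (y + w)"
    by (auto simp: coset_def algebra_simps)
  then show "z \<in> quotient_add (coset W x) (coset W y)"
    using assms subspace_0 unfolding quotient_add_def coset_def by blast
qed

lemma quotient_scale_coset:
  assumes "subspace W"
  shows "quotient_scale scale W c (coset W x) = coset W (scale c x)"
proof (intro equalityI subsetI)
  fix z assume "z \<in> quotient_scale scale W c (coset W x)"
  then obtain v w where vw: "v \<in> W" "w \<in> W" and z: "z = scale c (x + v) + w"
    by (auto simp: quotient_scale_def coset_def)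
  have "z = scale c x + (scale c v + w)" "scale c v + w \<in> W"
    using assms vw z by (auto simp: subspace_add subspace_scale scale_right_distrib add.assoc)
  then show "z \<in> coset W (scale c x)" by (auto simp: coset_def)
next
  fix z assume "z \<in> coset W (scale c x)"
  then obtain w where "w \<in> W" "z = scale c (x + 0) + w"
    by (auto simp: coset_def)
  then show "z \<in> quotient_scale scale W c (coset W x)"
    using assms subspace_0 unfolding quotient_scale_def coset_def by blast
qed

end


section \<open>The free associative algebra\<close>

text \<open>Words form a monoid under concatenation.  It is written additively because the
  library's convolution product on \<open>'a \<Rightarrow>\<^sub>0 'b\<close> multiplies \<open>x\<^sup>a\<close> and \<open>x\<^sup>b\<close> to \<open>x\<^sup>a\<^sup>+\<^sup>b\<close>; the
  (noncommutative) ring \<open>'g free_monoid \<Rightarrow>\<^sub>0 'k\<close> is therefore the free associative unital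
  \<open>'k\<close>-algebra on the set of all elements of \<open>'g\<close>.\<close>

datatype 'a free_monoid = Word (letters: "'a list")

instantiation free_monoid :: (type) monoid_add
begin

definition zero_free_monoid_def: "0 = Word []"

definition plus_free_monoid_def: "u + v = Word (letters u @ letters v)"

instance
  by standard (auto simp: zero_free_monoid_def plus_free_monoid_def)

end

definition free_algebra :: "'g set \<Rightarrow> ('g free_monoid \<Rightarrow>\<^sub>0 'k::field) ring" where
  "free_algebra L =
     \<lparr>carrier = {p. \<forall>w \<in> Poly_Mapping.keys p. set (letters w) \<subseteq> L},
      mult = (*), one = 1, zero = 0, add = (+)\<rparr>"

definition gen :: "'g \<Rightarrow> ('g free_monoid \<Rightarrow>\<^sub>0 'k::field)" where
  "gen x = Poly_Mapping.single (Word [x]) 1"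

definition const :: "'k \<Rightarrow> ('g free_monoid \<Rightarrow>\<^sub>0 'k::field)" where
  "const c = Poly_Mapping.single (Word []) c"

lemma free_algebra_simps [simp]:
  "p \<in> carrier (free_algebra L) \<longleftrightarrow> (\<forall>w \<in> Poly_Mapping.keys p. set (letters w) \<subseteq> L)"
  "x \<otimes>\<^bsub>free_algebra L\<^esub> y = x * y"
  "\<one>\<^bsub>free_algebra L\<^esub> = 1"
  "\<zero>\<^bsub>free_algebra L\<^esub> = 0"
  "x \<oplus>\<^bsub>free_algebra L\<^esub> y = x + y"
  by (simp_all add: free_algebra_def)

lemma free_algebra_closed:
  fixes p q :: "'g free_monoid \<Rightarrow>\<^sub>0 'k::field"
  assumes p: "p \<in> carrier (free_algebra L)" and q: "q \<in> carrier (free_algebra L)"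
  shows "p + q \<in> carrier (free_algebra L)"
    and "p - q \<in> carrier (free_algebra L)"
    and "p * q \<in> carrier (free_algebra L)"
proof -
  show "p + q \<in> carrier (free_algebra L)"
    using p q Poly_Mapping.keys_add[of p q] unfolding free_algebra_simps by blast
  show "p - q \<in> carrier (free_algebra L)"
    using p q keys_diff[of p q] unfolding free_algebra_simps by blast
  show "p * q \<in> carrier (free_algebra L)"
    unfolding free_algebra_simps
  proof
    fix w assume "w \<in> Poly_Mapping.keys (p * q)"
    then obtain u v where "u \<in> Poly_Mapping.keys p" "v \<in> Poly_Mapping.keys q" "w = u + v"
      using keys_mult[of p q] by blast
    then show "set (letters w) \<subseteq> L"
      using p q by (simp add: plus_free_monoid_def)
  qed
qed

lemma ring_free_algebra: "ring (free_algebra L :: ('g free_monoid \<Rightarrow>\<^sub>0 'k::field) ring)"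
proof -
  let ?R = "free_algebra L :: ('g free_monoid \<Rightarrow>\<^sub>0 'k) ring"
  have minus: "- p \<in> carrier ?R" if "p \<in> carrier ?R" for p
    using that by simp
  have zero: "0 \<in> carrier ?R" by simp
  have one: "1 \<in> carrier ?R" by (simp add: zero_free_monoid_def)
  note closed = free_algebra_closed
  note simps = free_algebra_simps(2-)
  show ?thesis
  proof (rule ringI)
    show "abelian_group ?R"
    proof (rule abelian_groupI, unfold simps)
      fix p assume "p \<in> carrier ?R"
      then show "\<exists>q\<in>carrier ?R. q + p = 0"
        using minus[of p] by (intro bexI[of _ "- p"]) simp_all
    qed (simp_all only: closed zero ac_simps add_0_left add_0_right)
    show "monoid ?R"
      by (rule monoidI, unfold simps)
        (simp_all only: closed one mult.assoc mult_1_left mult_1_right)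
  qed (simp_all only: simps distrib_left distrib_right)
qed


section \<open>Universal enveloping algebras\<close>

text \<open>The first two families of relations present the tensor algebra \<open>T(L)\<close> as a quotient of
  the free algebra on the set \<open>L\<close>; the third family cuts out \<open>U(L)\<close> as the quotient of \<open>T(L)\<close>
  by the ideal generated by all \<open>x \<otimes> y - y \<otimes> x - [x, y]\<close>.\<close>

definition enveloping_relations ::
    "('k::field \<Rightarrow> 'g::ab_group_add \<Rightarrow> 'g) \<Rightarrow> ('g \<Rightarrow> 'g \<Rightarrow> 'g) \<Rightarrow> 'g set
      \<Rightarrow> ('g free_monoid \<Rightarrow>\<^sub>0 'k) set" where
  "enveloping_relations scale bracket L =
     {gen (x + y) - gen x - gen y | x y. x \<in> L \<and> y \<in> L} \<union>
     {gen (scale c x) - const c * gen x | c x. x \<in> L} \<union>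
     {gen x * gen y - gen y * gen x - gen (bracket x y) | x y. x \<in> L \<and> y \<in> L}"

definition enveloping_ideal ::
    "('k::field \<Rightarrow> 'g::ab_group_add \<Rightarrow> 'g) \<Rightarrow> ('g \<Rightarrow> 'g \<Rightarrow> 'g) \<Rightarrow> 'g set
      \<Rightarrow> ('g free_monoid \<Rightarrow>\<^sub>0 'k) set" where
  "enveloping_ideal scale bracket L =
     genideal (free_algebra L) (enveloping_relations scale bracket L)"

definition enveloping_algebra ::
    "('k::field \<Rightarrow> 'g::ab_group_add \<Rightarrow> 'g) \<Rightarrow> ('g \<Rightarrow> 'g \<Rightarrow> 'g) \<Rightarrow> 'g set
      \<Rightarrow> ('g free_monoid \<Rightarrow>\<^sub>0 'k) set ring" where
  "enveloping_algebra scale bracket L =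
     free_algebra L Quot enveloping_ideal scale bracket L"

lemma (in lie_algebra) enveloping_relations_in_free_algebra:
  assumes "lie_subalgebra scale bracket L"
  shows "enveloping_relations scale bracket L \<subseteq> carrier (free_algebra L)"
proof -
  let ?R = "free_algebra L :: ('g free_monoid \<Rightarrow>\<^sub>0 'k) ring"
  have gen: "gen x \<in> carrier ?R" if "x \<in> L" for x
    using that by (simp add: gen_def)
  have const: "const c \<in> carrier ?R" for c
    by (simp add: const_def)
  have "subspace L" and br: "\<And>x y. x \<in> L \<Longrightarrow> y \<in> L \<Longrightarrow> bracket x y \<in> L"
    using assms by (auto simp: lie_subalgebra_def)
  then show ?thesis
    unfolding enveloping_relations_def
    by (auto simp del: free_algebra_simps
        intro!: free_algebra_closed(2,3) gen const br subspace_add subspace_scale)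
qed

lemma (in lie_algebra) ring_enveloping_algebra:
  assumes "lie_subalgebra scale bracket L"
  shows "ring (enveloping_algebra scale bracket L)"
proof -
  interpret R: ring "free_algebra L :: ('g free_monoid \<Rightarrow>\<^sub>0 'k) ring"
    by (rule ring_free_algebra)
  have "ideal (enveloping_ideal scale bracket L) (free_algebra L)"
    unfolding enveloping_ideal_def
    by (rule R.genideal_ideal[OF enveloping_relations_in_free_algebra[OF assms]])
  then show ?thesis
    unfolding enveloping_algebra_def by (rule ideal.quotient_is_ring)
qed


section \<open>Noetherian rings\<close>

text \<open>The library's \<open>noetherian_ring\<close> refers to two-sided ideals only, so it is not the right
  notion for noncommutative rings.\<close>

locale left_ideal = additive_subgroup I R + ring R for I and R (structure) +
  assumes l_closed: "\<lbrakk>a \<in> I; x \<in> carrier R\<rbrakk> \<Longrightarrow> x \<otimes> a \<in> I"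

locale right_ideal = additive_subgroup I R + ring R for I and R (structure) +
  assumes r_closed: "\<lbrakk>a \<in> I; x \<in> carrier R\<rbrakk> \<Longrightarrow> a \<otimes> x \<in> I"

definition left_noetherian :: "('a, 'b) ring_scheme \<Rightarrow> bool" where
  "left_noetherian R \<longleftrightarrow>
     (\<forall>I :: nat \<Rightarrow> 'a set. (\<forall>n. left_ideal (I n) R) \<and> (\<forall>n. I n \<subseteq> I (Suc n)) \<longrightarrow>
        (\<exists>N. \<forall>n\<ge>N. I n = I N))"

definition right_noetherian :: "('a, 'b) ring_scheme \<Rightarrow> bool" where
  "right_noetherian R \<longleftrightarrow>
     (\<forall>I :: nat \<Rightarrow> 'a set. (\<forall>n. right_ideal (I n) R) \<and> (\<forall>n. I n \<subseteq> I (Suc n)) \<longrightarrow>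
        (\<exists>N. \<forall>n\<ge>N. I n = I N))"

definition noetherian :: "('a, 'b) ring_scheme \<Rightarrow> bool" where
  "noetherian R \<longleftrightarrow> left_noetherian R \<and> right_noetherian R"

end

theory Submission
  imports Defs "HOL-Library.Multiset_Order"
begin

text \<open>
  Left ideals of \<open>U(L)\<close> are the left ideals of the free algebra on \<open>L\<close> that contain the ideal
  \<open>J L\<close> of relations, so the whole argument takes place inside the free algebra on \<open>\<gg>\<close>, the Lie
  algebra of all elements. Reversing words and negating letters is an anti-automorphism of \<open>U(L)\<close>, so
  only left ideals matter (\<open>noetherian_enveloping_algebra_iff\<close>).

  To pass from \<open>\<gg>\<close> to a subalgebra \<open>L\<close>, order a basis of \<open>\<gg>\<close> that extends a basis of \<open>L\<close>, with the new
  elements first. By the Poincare-Birkhoff-Witt theorem the nondecreasing words form a basis of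
  \<open>U(\<gg>)\<close>, so \<open>U(\<gg>)\<close> is a free right \<open>U(L)\<close>-module on the nondecreasing words in the new elements, and
  the coefficient of the empty word is a right \<open>U(L)\<close>-linear projection \<open>\<pi>\<close> from \<open>U(\<gg>)\<close> onto \<open>U(L)\<close>
  (\<open>ex_projection\<close>). Given \<open>\<pi>\<close>, a left ideal \<open>I\<close> of \<open>U(L)\<close> is recovered from the left ideal
  \<open>{p. \<forall>a. \<pi> (a p) \<in> I}\<close> of \<open>U(\<gg>)\<close> by intersecting with \<open>U(L)\<close>; hence ascending chains in \<open>U(L)\<close>
  become stationary if those in \<open>U(\<gg>)\<close> do. The same works for two subalgebras \<open>L \<subseteq> L'\<close>
  (\<open>noetherian_enveloping_subalgebra\<close>).

  To pass from \<open>\<hh>\<close> to \<open>\<gg>\<close>, note that \<open>\<hh>\<close> need not be an ideal, but the kernel \<open>\<kk>\<close> of its action on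
  \<open>\<gg>/\<hh>\<close> is an ideal of \<open>\<hh>\<close>, it still has finite codimension, and \<open>U(\<kk>)\<close> is noetherian by the first
  part. Give \<open>\<kk>\<close>, \<open>\<hh>\<close> and \<open>\<gg>\<close> the weights 0, 1 and 2. Then \<open>[\<kk>,\<hh>] \<subseteq> \<kk>\<close>, \<open>[\<kk>,\<gg>] \<subseteq> \<hh>\<close>, \<open>[\<hh>,\<hh>] \<subseteq> \<hh>\<close> and
  \<open>[\<gg>,\<gg>] \<subseteq> \<gg>\<close> say that a bracket has smaller weight than the product as soon as one factor lies
  outside \<open>\<kk>\<close>. So finitely many generators \<open>z\<^sub>i\<close> that span \<open>\<gg>\<close> modulo \<open>\<kk>\<close> commute with each other and
  with \<open>U(\<kk>)\<close> up to terms of smaller weight, and \<open>U(\<gg>)\<close> is filtered with an associated graded ring that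
  is a quotient of the polynomial ring \<open>U(\<kk>)[z\<^sub>1,\<dots>,z\<^sub>N]\<close>. Hilbert's basis theorem then applies: the
  leading coefficients of a left ideal at the monomials \<open>z\<^sup>\<alpha>\<close> form a family of left ideals of
  \<open>U(\<kk>)\<close> that grows with \<open>\<alpha>\<close>, Dickson's lemma makes an ascending chain of such families
  stationary, and a left ideal is determined within a larger one by its leading coefficients
  (\<open>noetherian_enveloping_UNIV\<close>).
\<close>

section \<open>Linear maps on the free algebra\<close>

declare free_algebra_simps(1) [simp del]

definition word :: "'g list \<Rightarrow> ('g free_monoid \<Rightarrow>\<^sub>0 'k::field)" where
  "word w = Poly_Mapping.single (Word w) 1"

lemma gen_eq_word: "gen x = word [x]"
  by (simp add: gen_def word_def)

lemma word_Nil: "word [] = 1"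
  by (metis single_one zero_free_monoid_def word_def)

lemma word_append: "word (u @ v) = word u * word v"
  by (simp add: word_def mult_single plus_free_monoid_def)

lemma word_Cons: "word (x # v) = gen x * word v"
  using word_append[of "[x]" v] by (simp add: gen_eq_word)

lemma const_mult: "const c * const d = const (c * d)"
  by (simp add: const_def mult_single plus_free_monoid_def)

lemma const_add: "const (c + d) = const c + const d"
  by (simp add: const_def single_add)

lemma const_0 [simp]: "const 0 = 0"
  by (simp add: const_def)

lemma const_1 [simp]: "const 1 = 1"
  using word_Nil by (simp add: const_def word_def)

lemma const_uminus: "const (- c) = - const c"
  by (simp add: const_def single_uminus)

lemma const_times_word: "const c * word w = Poly_Mapping.single (Word w) c"
  by (simp add: const_def word_def mult_single plus_free_monoid_def)

lemma sum_words: "p = (\<Sum>w\<in>Poly_Mapping.keys p. const (Poly_Mapping.lookup p w) * word (letters w))"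
proof (rule poly_mapping_eqI)
  fix w
  have "Poly_Mapping.lookup (\<Sum>w\<in>Poly_Mapping.keys p. const (Poly_Mapping.lookup p w) * word (letters w)) w
    = (\<Sum>v\<in>Poly_Mapping.keys p. if v = w then Poly_Mapping.lookup p v else 0)"
    by (simp add: const_times_word lookup_sum lookup_single when_def)
  then show "Poly_Mapping.lookup p w
    = Poly_Mapping.lookup (\<Sum>w\<in>Poly_Mapping.keys p. const (Poly_Mapping.lookup p w) * word (letters w)) w"
    by (simp add: in_keys_iff)
qed

text \<open>The free algebra is spanned by the words, so a linear statement needs to be checked on words
  only; all computations below are done in this way.\<close>

lemma free_algebra_induct [consumes 1, case_names zero add scale word]:
  assumes p: "p \<in> carrier (free_algebra L)"
    and zero: "P 0"
    and add: "\<And>p q. P p \<Longrightarrow> P q \<Longrightarrow> P (p + q)"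
    and scale: "\<And>c p. P p \<Longrightarrow> P (const c * p)"
    and word: "\<And>w. set w \<subseteq> L \<Longrightarrow> P (word w)"
  shows "P p"
proof -
  have "P (\<Sum>w\<in>S. const (Poly_Mapping.lookup p w) * word (letters w))"
    if "finite S" "S \<subseteq> Poly_Mapping.keys p" for S
    using that p
    by (induction S) (auto simp: free_algebra_simps(1) intro!: zero add scale word)
  from this[OF finite_keys order_refl] show ?thesis
    by (subst sum_words)
qed

lemma free_algebra_UNIV [simp]: "p \<in> carrier (free_algebra UNIV)"
  by (simp add: free_algebra_simps(1))

lemmas free_algebra_UNIV_induct =
  free_algebra_induct[OF free_algebra_UNIV, case_names zero add scale word]

lemma const_commute: "const c * p = p * const c"
proof (induction p rule: free_algebra_UNIV_induct)
  case (scale d p)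
  have "const c * (const d * p) = const d * (const c * p)"
    by (simp add: const_mult mult.commute[of c] flip: mult.assoc)
  then show ?case by (simp only: scale mult.assoc)
qed (simp_all add: distrib_left distrib_right const_def word_def mult_single plus_free_monoid_def)

lemma const_left_commute: "p * (const c * q) = const c * (p * q)"
  by (metis const_commute mult.assoc)

interpretation FA: vector_space "\<lambda>c. (*) (const c :: 'g free_monoid \<Rightarrow>\<^sub>0 'k::field)"
  by unfold_locales (simp_all add: distrib_left distrib_right const_add const_mult flip: mult.assoc)

lemma subspace_free_algebra: "FA.subspace (carrier (free_algebra L))"
proof -
  have "const c * p \<in> carrier (free_algebra L)" if "p \<in> carrier (free_algebra L)" for c p
    by (rule free_algebra_closed(3)[OF _ that]) (simp add: const_def free_algebra_simps(1))
  then show ?thesis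
    unfolding FA.subspace_def
    by (auto simp: free_algebra_closed(1)) (simp add: free_algebra_simps(1))
qed

lemma word_in_free_algebra: "set w \<subseteq> L \<Longrightarrow> word w \<in> carrier (free_algebra L)"
  by (simp add: free_algebra_simps(1) word_def)

definition lift ::
    "('g list \<Rightarrow> ('h free_monoid \<Rightarrow>\<^sub>0 'k)) \<Rightarrow> ('g free_monoid \<Rightarrow>\<^sub>0 'k::field) \<Rightarrow> ('h free_monoid \<Rightarrow>\<^sub>0 'k)"
  where "lift f p = (\<Sum>w\<in>Poly_Mapping.keys p. const (Poly_Mapping.lookup p w) * f (letters w))"

lemma lift_superset:
  assumes "finite S" "Poly_Mapping.keys p \<subseteq> S"
  shows "lift f p = (\<Sum>w\<in>S. const (Poly_Mapping.lookup p w) * f (letters w))"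
  unfolding lift_def using assms
  by (intro sum.mono_neutral_left) (auto simp: in_keys_iff)

lemma lift_word [simp]: "lift f (word w) = f w"
  by (simp add: lift_def word_def)

lemma lift_0 [simp]: "lift f 0 = 0"
  by (simp add: lift_def)

lemma lift_add: "lift f (p + q) = lift f p + lift f q"
proof -
  let ?S = "Poly_Mapping.keys p \<union> Poly_Mapping.keys q"
  have "lift f r = (\<Sum>w\<in>?S. const (Poly_Mapping.lookup r w) * f (letters w))"
    if "Poly_Mapping.keys r \<subseteq> ?S" for r
    using that by (intro lift_superset) auto
  from this[of p] this[of q] this[of "p + q"] show ?thesis
    using Poly_Mapping.keys_add[of p q]
    by (simp add: lookup_add const_add distrib_right sum.distrib)
qed

lemma lookup_const_mult: "Poly_Mapping.lookup (const c * p) w = c * Poly_Mapping.lookup p w"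
proof -
  have "const c * p = Poly_Mapping.map ((*) c) p"
    by (simp add: const_def mult_map_scale_conv_mult zero_free_monoid_def)
  then show ?thesis
    by (simp add: Poly_Mapping.map.rep_eq when_def)
qed

lemma lift_scale: "lift f (const c * p) = const c * lift f p"
proof -
  have "lift f (const c * p) =
      (\<Sum>w\<in>Poly_Mapping.keys p. const (Poly_Mapping.lookup (const c * p) w) * f (letters w))"
    by (rule lift_superset) (auto simp: in_keys_iff lookup_const_mult)
  then show ?thesis
    by (simp add: lift_def lookup_const_mult sum_distrib_left const_mult flip: mult.assoc)
qed

lemma lift_uminus: "lift f (- p) = - lift f p"
  using lift_scale[of f "-1" p] by (simp add: const_uminus)

lemma lift_diff: "lift f (p - q) = lift f p - lift f q"
  using lift_add[of f p "- q"] by (simp add: lift_uminus)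

lemma lift_sum: "lift f (sum g S) = (\<Sum>x\<in>S. lift f (g x))"
  by (induction S rule: infinite_finite_induct) (simp_all add: lift_add)

lemma lift_mult:
  assumes "\<And>u v. f (u @ v) = f u * f v"
  shows "lift f (p * q) = lift f p * lift f q"
proof (induction p rule: free_algebra_UNIV_induct)
  case (word u)
  show ?case
  proof (induction q rule: free_algebra_UNIV_induct)
    case (word v)
    show ?case by (simp add: assms flip: word_append)
  qed (simp_all add: lift_add lift_scale distrib_left const_left_commute)
qed (simp_all add: lift_add lift_scale distrib_right mult.assoc)

lemma lift_in_subspace:
  assumes "p \<in> carrier (free_algebra L)" "FA.subspace S" "\<And>w. set w \<subseteq> L \<Longrightarrow> f w \<in> S"
  shows "lift f p \<in> S"
  using assms(1)
  by (induction rule: free_algebra_induct)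
    (simp_all add: lift_add lift_scale assms(3) FA.subspace_0[OF assms(2)]
      FA.subspace_add[OF assms(2)] FA.subspace_scale[OF assms(2)])

section \<open>One-sided ideals of quotient rings\<close>

lemma (in ring) left_ideal_iff:
  "left_ideal K R \<longleftrightarrow> K \<subseteq> carrier R \<and> \<zero> \<in> K \<and>
     (\<forall>a\<in>K. \<forall>b\<in>K. a \<oplus> b \<in> K) \<and> (\<forall>x\<in>carrier R. \<forall>a\<in>K. x \<otimes> a \<in> K)" (is "_ \<longleftrightarrow> ?rhs")
proof
  assume "left_ideal K R"
  then interpret left_ideal K R .
  show ?rhs
    using a_subset zero_closed a_closed l_closed by blast
next
  assume K: ?rhs
  have "\<ominus> a \<in> K" if "a \<in> K" for a
  proof -
    have "\<ominus> a = (\<ominus> \<one>) \<otimes> a" using K that by (simp add: l_minus subset_iff)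
    then show ?thesis using K that by simp
  qed
  then have "subgroup K (add_monoid R)"
    using K by (intro add.subgroupI) (auto simp: a_inv_def)
  then show "left_ideal K R"
    using K by (intro left_ideal.intro additive_subgroup.intro left_ideal_axioms.intro ring_axioms) auto
qed

lemma (in ring) right_ideal_iff:
  "right_ideal K R \<longleftrightarrow> K \<subseteq> carrier R \<and> \<zero> \<in> K \<and>
     (\<forall>a\<in>K. \<forall>b\<in>K. a \<oplus> b \<in> K) \<and> (\<forall>x\<in>carrier R. \<forall>a\<in>K. a \<otimes> x \<in> K)" (is "_ \<longleftrightarrow> ?rhs")
proof
  assume "right_ideal K R"
  then interpret right_ideal K R .
  show ?rhs
    using a_subset zero_closed a_closed r_closed by blast
next
  assume K: ?rhs
  have "\<ominus> a \<in> K" if "a \<in> K" for a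
  proof -
    have "\<ominus> a = a \<otimes> (\<ominus> \<one>)" using K that by (simp add: r_minus subset_iff)
    then show ?thesis using K that by simp
  qed
  then have "subgroup K (add_monoid R)"
    using K by (intro add.subgroupI) (auto simp: a_inv_def)
  then show "right_ideal K R"
    using K by (intro right_ideal.intro additive_subgroup.intro right_ideal_axioms.intro ring_axioms) auto
qed

lemma (in ideal) left_ideal_vimage:
  assumes "left_ideal K (R Quot I)"
  shows "left_ideal {x \<in> carrier R. I +> x \<in> K} R"
    and "I \<subseteq> {x \<in> carrier R. I +> x \<in> K}"
    and "K = (+>) I ` {x \<in> carrier R. I +> x \<in> K}"
proof -
  interpret Q: ring "R Quot I" by (rule quotient_is_ring)
  have K: "K \<subseteq> a_rcosets I" "I \<in> K" "\<And>A B. A \<in> K \<Longrightarrow> B \<in> K \<Longrightarrow> A <+> B \<in> K"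
    "\<And>A B. A \<in> a_rcosets I \<Longrightarrow> B \<in> K \<Longrightarrow> [mod I:] A \<Otimes> B \<in> K"
    using assms[unfolded Q.left_ideal_iff] by (auto simp: FactRing_def)
  show "left_ideal {x \<in> carrier R. I +> x \<in> K} R"
    unfolding left_ideal_iff
  proof (intro conjI ballI)
    show "\<zero> \<in> {x \<in> carrier R. I +> x \<in> K}"
      using K(2) a_rcos_const[OF additive_subgroup.zero_closed[OF is_additive_subgroup]] by simp
    fix a b assume "a \<in> {x \<in> carrier R. I +> x \<in> K}" "b \<in> {x \<in> carrier R. I +> x \<in> K}"
    then show "a \<oplus> b \<in> {x \<in> carrier R. I +> x \<in> K}"
      using K(3)[of "I +> a" "I +> b"] by (simp add: a_rcos_sum)
  next
    fix x a assume "x \<in> carrier R" "a \<in> {x \<in> carrier R. I +> x \<in> K}"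
    then show "x \<otimes> a \<in> {x \<in> carrier R. I +> x \<in> K}"
      using K(4)[of "I +> x" "I +> a"]
      by (simp add: rcoset_mult_add a_rcosetsI[OF a_subset])
  qed auto
  show "I \<subseteq> {x \<in> carrier R. I +> x \<in> K}"
    using K(2) a_subset by (auto simp: a_rcos_const)
  show "K = (+>) I ` {x \<in> carrier R. I +> x \<in> K}"
    using K(1) by (auto simp: A_RCOSETS_def' image_iff)
qed

lemma (in ideal) left_ideal_image:
  assumes K: "left_ideal K R" and IK: "I \<subseteq> K"
  shows "left_ideal ((+>) I ` K) (R Quot I)"
    and "{x \<in> carrier R. I +> x \<in> (+>) I ` K} = K"
proof -
  interpret Q: ring "R Quot I" by (rule quotient_is_ring)
  have K': "K \<subseteq> carrier R" "\<zero> \<in> K" "\<And>a b. a \<in> K \<Longrightarrow> b \<in> K \<Longrightarrow> a \<oplus> b \<in> K"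
    "\<And>x a. x \<in> carrier R \<Longrightarrow> a \<in> K \<Longrightarrow> x \<otimes> a \<in> K"
    using K[unfolded left_ideal_iff] by auto
  show "left_ideal ((+>) I ` K) (R Quot I)"
    unfolding Q.left_ideal_iff
  proof (intro conjI ballI)
    show "(+>) I ` K \<subseteq> carrier (R Quot I)"
      using K'(1) by (auto simp: FactRing_def a_rcosetsI[OF a_subset])
    show "\<zero>\<^bsub>R Quot I\<^esub> \<in> (+>) I ` K"
      using K'(2) a_rcos_const[OF additive_subgroup.zero_closed[OF is_additive_subgroup]] by (auto simp: FactRing_def image_iff)
  next
    fix A B assume "A \<in> (+>) I ` K" "B \<in> (+>) I ` K"
    then obtain a b where "a \<in> K" "b \<in> K" "A = I +> a" "B = I +> b" by auto
    then show "A \<oplus>\<^bsub>R Quot I\<^esub> B \<in> (+>) I ` K"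
      using K'(1,3) by (auto simp: FactRing_def a_rcos_sum subset_iff)
  next
    fix A B assume "A \<in> carrier (R Quot I)" "B \<in> (+>) I ` K"
    then obtain a b where "a \<in> carrier R" "b \<in> K" "A = I +> a" "B = I +> b"
      by (auto simp: FactRing_def A_RCOSETS_def')
    then show "A \<otimes>\<^bsub>R Quot I\<^esub> B \<in> (+>) I ` K"
      using K'(1,4) by (auto simp: FactRing_def rcoset_mult_add subset_iff)
  qed
  show "{x \<in> carrier R. I +> x \<in> (+>) I ` K} = K"
  proof (intro equalityI subsetI)
    fix x assume "x \<in> {x \<in> carrier R. I +> x \<in> (+>) I ` K}"
    then obtain a where x: "x \<in> carrier R" and a: "a \<in> K" and eq: "I +> x = I +> a" by auto
    have "x \<in> I +> a" using a_rcos_self[OF x] eq by simp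
    then obtain i where "i \<in> I" "x = i \<oplus> a" by (auto simp: a_r_coset_def')
    then show "x \<in> K" using IK a K'(3) by auto
  qed (use K'(1) in auto)
qed

text \<open>Left ideals of a quotient ring are the left ideals that contain the ideal divided out.\<close>

lemma (in ideal) left_noetherian_quotient_iff:
  "left_noetherian (R Quot I) \<longleftrightarrow>
    (\<forall>K :: nat \<Rightarrow> 'a set. (\<forall>n. left_ideal (K n) R \<and> I \<subseteq> K n) \<and> (\<forall>n. K n \<subseteq> K (Suc n)) \<longrightarrow>
      (\<exists>N. \<forall>n\<ge>N. K n = K N))" (is "_ \<longleftrightarrow> ?rhs")
proof
  assume acc: "left_noetherian (R Quot I)"
  show ?rhs
  proof (intro allI impI)
    fix K :: "nat \<Rightarrow> 'a set"
    assume "(\<forall>n. left_ideal (K n) R \<and> I \<subseteq> K n) \<and> (\<forall>n. K n \<subseteq> K (Suc n))"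
    then have K: "left_ideal (K n) R" "I \<subseteq> K n" "K n \<subseteq> K (Suc n)" for n by auto
    have "\<forall>n. left_ideal ((+>) I ` K n) (R Quot I)" "\<forall>n. (+>) I ` K n \<subseteq> (+>) I ` K (Suc n)"
      using left_ideal_image(1)[OF K(1,2)] K(3) by auto
    then obtain N where N: "\<And>n. n \<ge> N \<Longrightarrow> (+>) I ` K n = (+>) I ` K N"
      using acc[unfolded left_noetherian_def, rule_format, of "\<lambda>n. (+>) I ` K n"] by auto
    show "\<exists>N. \<forall>n\<ge>N. K n = K N"
      using left_ideal_image(2)[OF K(1,2)] N by metis
  qed
next
  assume acc: ?rhs
  show "left_noetherian (R Quot I)"
    unfolding left_noetherian_def
  proof (intro allI impI)
    fix K :: "nat \<Rightarrow> 'a set set"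
    assume "(\<forall>n. left_ideal (K n) (R Quot I)) \<and> (\<forall>n. K n \<subseteq> K (Suc n))"
    then have K: "left_ideal (K n) (R Quot I)" "K n \<subseteq> K (Suc n)" for n by auto
    define V where "V n = {x \<in> carrier R. I +> x \<in> K n}" for n
    have "(\<forall>n. left_ideal (V n) R \<and> I \<subseteq> V n) \<and> (\<forall>n. V n \<subseteq> V (Suc n))"
      unfolding V_def using left_ideal_vimage(1,2)[OF K(1)] K(2) by blast
    then obtain N where N: "\<And>n. n \<ge> N \<Longrightarrow> V n = V N"
      using acc by metis
    have "K n = (+>) I ` V n" for n
      using left_ideal_vimage(3)[OF K(1)] by (simp add: V_def)
    then show "\<exists>N. \<forall>n\<ge>N. K n = K N"
      using N by metis
  qed
qed

text \<open>Involutive anti-automorphisms suffice for exchanging left and right; being their own inverses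
  they pass to quotients without a separate surjectivity argument.\<close>

definition anti_involution :: "('a, 'b) ring_scheme \<Rightarrow> ('a \<Rightarrow> 'a) \<Rightarrow> bool" where
  "anti_involution R f \<longleftrightarrow>
     (\<forall>x\<in>carrier R. f x \<in> carrier R \<and> f (f x) = x) \<and>
     (\<forall>x\<in>carrier R. \<forall>y\<in>carrier R. f (x \<oplus>\<^bsub>R\<^esub> y) = f x \<oplus>\<^bsub>R\<^esub> f y \<and> f (x \<otimes>\<^bsub>R\<^esub> y) = f y \<otimes>\<^bsub>R\<^esub> f x)"

lemma (in ring) anti_involution_zero:
  assumes "anti_involution R f"
  shows "f \<zero> = \<zero>"
proof -
  have "f (\<zero> \<oplus> \<zero>) = f \<zero> \<oplus> f \<zero>" "f \<zero> \<in> carrier R"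
    using assms unfolding anti_involution_def by blast+
  then show ?thesis
    using add.l_cancel_one' by fastforce
qed

lemma (in ring) anti_involution_image_ideal:
  assumes f: "anti_involution R f"
  shows "left_ideal K R \<Longrightarrow> right_ideal (f ` K) R"
    and "right_ideal K R \<Longrightarrow> left_ideal (f ` K) R"
proof -
  have f': "\<And>x. x \<in> carrier R \<Longrightarrow> f x \<in> carrier R" "\<And>x. x \<in> carrier R \<Longrightarrow> f (f x) = x"
    "\<And>x y. x \<in> carrier R \<Longrightarrow> y \<in> carrier R \<Longrightarrow> f (x \<oplus> y) = f x \<oplus> f y"
    "\<And>x y. x \<in> carrier R \<Longrightarrow> y \<in> carrier R \<Longrightarrow> f (x \<otimes> y) = f y \<otimes> f x"
    using f by (auto simp: anti_involution_def)
  have zero: "\<zero> \<in> f ` K" if "\<zero> \<in> K"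
    using that anti_involution_zero[OF f] by (metis image_eqI)
  have add: "f a \<oplus> f b \<in> f ` K" if "K \<subseteq> carrier R" "a \<oplus> b \<in> K" "a \<in> K" "b \<in> K" for a b
    using that f'(3)[of a b] by (metis imageI subsetD)
  show "right_ideal (f ` K) R" if K: "left_ideal K R"
  proof -
    have "f a \<otimes> x \<in> f ` K" if "x \<in> carrier R" "a \<in> K" for x a
      using K[unfolded left_ideal_iff] that f'
      by (intro image_eqI[of _ f "f x \<otimes> a"]) auto
    then show ?thesis
      using K zero add f' unfolding left_ideal_iff right_ideal_iff by blast
  qed
  show "left_ideal (f ` K) R" if K: "right_ideal K R"
  proof -
    have "x \<otimes> f a \<in> f ` K" if "x \<in> carrier R" "a \<in> K" for x a
      using K[unfolded right_ideal_iff] that f'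
      by (intro image_eqI[of _ f "a \<otimes> f x"]) auto
    then show ?thesis
      using K zero add f' unfolding left_ideal_iff right_ideal_iff by blast
  qed
qed

lemma (in ring) left_noetherian_iff_right_noetherian:
  assumes f: "anti_involution R f"
  shows "left_noetherian R \<longleftrightarrow> right_noetherian R"
proof -
  have inv: "f ` f ` K = K" if "K \<subseteq> carrier R" for K
    using f that by (force simp: anti_involution_def image_iff)
  have *: "\<exists>N. \<forall>n\<ge>N. K n = K N"
    if "\<exists>N. \<forall>n\<ge>N. f ` K n = f ` K N" "\<And>n. K n \<subseteq> carrier R" for K :: "nat \<Rightarrow> 'a set"
    using that inv by metis
  have mono: "\<forall>n. f ` K n \<subseteq> f ` K (Suc n)" if "\<forall>n. K n \<subseteq> K (Suc n)" for K :: "nat \<Rightarrow> 'a set"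
    using that by blast
  show ?thesis
  proof
    assume acc: "left_noetherian R"
    show "right_noetherian R"
      unfolding right_noetherian_def
    proof (intro allI impI, elim conjE)
      fix K :: "nat \<Rightarrow> 'a set"
      assume K: "\<forall>n. right_ideal (K n) R" "\<forall>n. K n \<subseteq> K (Suc n)"
      have "\<forall>n. left_ideal (f ` K n) R"
        using K(1) anti_involution_image_ideal(2)[OF f] by blast
      then have "\<exists>N. \<forall>n\<ge>N. f ` K n = f ` K N"
        using acc[unfolded left_noetherian_def, rule_format, of "\<lambda>n. f ` K n"] mono[OF K(2)] by simp
      moreover have "K n \<subseteq> carrier R" for n
        using K(1) unfolding right_ideal_iff by blast
      ultimately show "\<exists>N. \<forall>n\<ge>N. K n = K N" by (rule *)
    qed
  next
    assume acc: "right_noetherian R"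
    show "left_noetherian R"
      unfolding left_noetherian_def
    proof (intro allI impI, elim conjE)
      fix K :: "nat \<Rightarrow> 'a set"
      assume K: "\<forall>n. left_ideal (K n) R" "\<forall>n. K n \<subseteq> K (Suc n)"
      have "\<forall>n. right_ideal (f ` K n) R"
        using K(1) anti_involution_image_ideal(1)[OF f] by blast
      then have "\<exists>N. \<forall>n\<ge>N. f ` K n = f ` K N"
        using acc[unfolded right_noetherian_def, rule_format, of "\<lambda>n. f ` K n"] mono[OF K(2)] by simp
      moreover have "K n \<subseteq> carrier R" for n
        using K(1) unfolding left_ideal_iff by blast
      ultimately show "\<exists>N. \<forall>n\<ge>N. K n = K N" by (rule *)
    qed
  qed
qed

text \<open>Cosets are sets, so the induced map is the image map.\<close>

lemma (in ideal) anti_involution_quotient: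
  assumes f: "anti_involution R f" and I: "f ` I \<subseteq> I"
  shows "anti_involution (R Quot I) ((`) f)"
proof -
  have f': "\<And>x. x \<in> carrier R \<Longrightarrow> f x \<in> carrier R" "\<And>x. x \<in> carrier R \<Longrightarrow> f (f x) = x"
    "\<And>x y. x \<in> carrier R \<Longrightarrow> y \<in> carrier R \<Longrightarrow> f (x \<oplus> y) = f x \<oplus> f y"
    "\<And>x y. x \<in> carrier R \<Longrightarrow> y \<in> carrier R \<Longrightarrow> f (x \<otimes> y) = f y \<otimes> f x"
    using f by (auto simp: anti_involution_def)
  have sub: "f ` (I +> x) \<subseteq> I +> f x" if "x \<in> carrier R" for x
    using that I f'(3) a_subset by (auto simp: a_r_coset_def' subset_iff)
  have coset: "f ` (I +> x) = I +> f x" if "x \<in> carrier R" for x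
  proof
    have "f ` f ` (I +> f x) \<subseteq> f ` (I +> f (f x))"
      using sub f'(1)[OF that] by blast
    moreover have "f ` f ` (I +> f x) = I +> f x"
    proof -
      have "I +> f x \<subseteq> carrier R"
        using f'(1)[OF that] a_subset by (simp add: a_r_coset_subset_G)
      then have "f (f y) = y" if "y \<in> I +> f x" for y
        using f'(2) that by blast
      then show ?thesis by (simp add: image_image)
    qed
    ultimately show "I +> f x \<subseteq> f ` (I +> x)" using f'(2)[OF that] by simp
  qed (rule sub[OF that])
  show ?thesis
    unfolding anti_involution_def
    by (auto simp: FactRing_simps coset f' rcoset_mult_add a_rcos_sum)
qed

section \<open>Left ideals of the enveloping algebra inside the free algebra\<close>

context lie_algebra
begin

abbreviation J :: "'g set \<Rightarrow> ('g free_monoid \<Rightarrow>\<^sub>0 'k) set" where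
  "J \<equiv> enveloping_ideal scale bracket"

abbreviation A :: "'g set \<Rightarrow> ('g free_monoid \<Rightarrow>\<^sub>0 'k) set" where
  "A L \<equiv> carrier (free_algebra L)"

abbreviation liesub :: "'g set \<Rightarrow> bool" where
  "liesub \<equiv> lie_subalgebra scale bracket"

lemma bracket_0_left [simp]: "bracket 0 y = 0"
  using bracket_scale_left[of 0 0 y] by simp

lemma bracket_0_right [simp]: "bracket x 0 = 0"
  using bracket_scale_right[of x 0 0] by simp

lemma bracket_antisym: "bracket y x = - bracket x y"
proof -
  have "bracket (x + y) (x + y) = bracket x y + bracket y x"
    by (simp only: bracket_add_left bracket_add_right) (simp add: bracket_self add.commute)
  then have "bracket x y + bracket y x = 0" using bracket_self[of "x + y"] by simp
  then show ?thesis by (simp add: eq_neg_iff_add_eq_0 add.commute)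
qed

lemma free_algebra_mono: "L \<subseteq> L' \<Longrightarrow> A L \<subseteq> A L'"
  unfolding subset_iff free_algebra_simps(1) by blast

lemma gen_in_free_algebra: "x \<in> L \<Longrightarrow> gen x \<in> A L"
  by (simp add: gen_eq_word word_in_free_algebra)

lemma const_in_free_algebra: "const c \<in> A L"
  by (simp add: const_def free_algebra_simps(1))

lemma scale_in_free_algebra: "p \<in> A L \<Longrightarrow> const c * p \<in> A L"
  by (simp add: const_in_free_algebra free_algebra_closed)

lemma ideal_enveloping_ideal: "liesub L \<Longrightarrow> ideal (J L) (free_algebra L)"
  unfolding enveloping_ideal_def
  by (rule ring.genideal_ideal[OF ring_free_algebra enveloping_relations_in_free_algebra])

lemma enveloping_ideal_closed:
  assumes "liesub L"
  shows "J L \<subseteq> A L" and "0 \<in> J L"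
    and "p \<in> J L \<Longrightarrow> q \<in> J L \<Longrightarrow> p + q \<in> J L"
    and "p \<in> J L \<Longrightarrow> a \<in> A L \<Longrightarrow> a * p \<in> J L"
    and "p \<in> J L \<Longrightarrow> a \<in> A L \<Longrightarrow> p * a \<in> J L"
    and "p \<in> J L \<Longrightarrow> const c * p \<in> J L"
    and "p \<in> J L \<Longrightarrow> - p \<in> J L"
    and "p \<in> J L \<Longrightarrow> q \<in> J L \<Longrightarrow> p - q \<in> J L"
proof -
  interpret ideal "J L" "free_algebra L" by (rule ideal_enveloping_ideal[OF assms])
  show "J L \<subseteq> A L" using a_subset .
  show "0 \<in> J L" using additive_subgroup.zero_closed[OF is_additive_subgroup] by simp
  show add: "p \<in> J L \<Longrightarrow> q \<in> J L \<Longrightarrow> p + q \<in> J L" for p q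
    using additive_subgroup.a_closed[OF is_additive_subgroup] by simp
  show l: "p \<in> J L \<Longrightarrow> a \<in> A L \<Longrightarrow> a * p \<in> J L" for a p
    using I_l_closed by simp
  show "p \<in> J L \<Longrightarrow> a \<in> A L \<Longrightarrow> p * a \<in> J L"
    using I_r_closed by simp
  show s: "p \<in> J L \<Longrightarrow> const c * p \<in> J L" for c p
    using l const_in_free_algebra by blast
  show m: "p \<in> J L \<Longrightarrow> - p \<in> J L" for p
    using s[of p "-1"] by (simp add: const_uminus)
  show "p \<in> J L \<Longrightarrow> q \<in> J L \<Longrightarrow> p - q \<in> J L"
    using add[OF _ m] by simp
qed

lemma subspace_enveloping_ideal: "liesub L \<Longrightarrow> FA.subspace (J L)"
  by (simp add: FA.subspace_def enveloping_ideal_closed)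

lemma enveloping_ideal_relations:
  assumes "liesub L"
  shows "x \<in> L \<Longrightarrow> y \<in> L \<Longrightarrow> gen (x + y) - gen x - gen y \<in> J L"
    and "x \<in> L \<Longrightarrow> gen (scale c x) - const c * gen x \<in> J L"
    and "x \<in> L \<Longrightarrow> y \<in> L \<Longrightarrow> gen x * gen y - gen y * gen x - gen (bracket x y) \<in> J L"
proof -
  have "enveloping_relations scale bracket L \<subseteq> J L"
    unfolding enveloping_ideal_def
    by (rule ring.genideal_self[OF ring_free_algebra enveloping_relations_in_free_algebra[OF assms]])
  then have rel: "r \<in> J L" if "r \<in> enveloping_relations scale bracket L" for r
    using that by blast
  show "x \<in> L \<Longrightarrow> y \<in> L \<Longrightarrow> gen (x + y) - gen x - gen y \<in> J L"
    by (rule rel, unfold enveloping_relations_def, rule UnI1, rule UnI1, blast)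
  show "x \<in> L \<Longrightarrow> gen (scale c x) - const c * gen x \<in> J L"
    by (rule rel, unfold enveloping_relations_def, rule UnI1, rule UnI2, blast)
  show "x \<in> L \<Longrightarrow> y \<in> L \<Longrightarrow> gen x * gen y - gen y * gen x - gen (bracket x y) \<in> J L"
    by (rule rel, unfold enveloping_relations_def, rule UnI2, blast)
qed

text \<open>The induction principle for the ideal of relations: a linear map kills \<open>J L\<close> once the
  elements that it kills after multiplication on both sides contain the generators.\<close>

lemma enveloping_ideal_least:
  assumes "K \<subseteq> A L" "0 \<in> K" "\<And>p q. p \<in> K \<Longrightarrow> q \<in> K \<Longrightarrow> p + q \<in> K"
    and "\<And>a p. a \<in> A L \<Longrightarrow> p \<in> K \<Longrightarrow> a * p \<in> K"
    and "\<And>a p. a \<in> A L \<Longrightarrow> p \<in> K \<Longrightarrow> p * a \<in> K"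
    and "\<And>x y. x \<in> L \<Longrightarrow> y \<in> L \<Longrightarrow> gen (x + y) - gen x - gen y \<in> K"
    and "\<And>c x. x \<in> L \<Longrightarrow> gen (scale c x) - const c * gen x \<in> K"
    and "\<And>x y. x \<in> L \<Longrightarrow> y \<in> L \<Longrightarrow> gen x * gen y - gen y * gen x - gen (bracket x y) \<in> K"
  shows "J L \<subseteq> K"
proof -
  interpret R: ring "free_algebra L :: ('g free_monoid \<Rightarrow>\<^sub>0 'k) ring" by (rule ring_free_algebra)
  have "left_ideal K (free_algebra L)"
    using assms(1-4) by (simp add: R.left_ideal_iff)
  then have "ideal K (free_algebra L)"
    using assms(5)
    by (intro ideal.intro ideal_axioms.intro R.ring_axioms) (auto simp: left_ideal_def left_ideal_axioms_def)
  moreover have "enveloping_relations scale bracket L \<subseteq> K"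
    using assms(6-8) unfolding enveloping_relations_def by auto
  ultimately show ?thesis
    unfolding enveloping_ideal_def by (rule R.genideal_minimal)
qed

lemma enveloping_ideal_mono:
  assumes L: "liesub L" and L': "liesub L'" and sub: "L \<subseteq> L'"
  shows "J L \<subseteq> J L'"
proof -
  have A: "A L \<subseteq> A L'" by (rule free_algebra_mono[OF sub])
  note J = enveloping_ideal_closed[OF L] enveloping_ideal_closed[OF L']
  \<comment> \<open>The intersection with \<open>J L\<close> keeps the candidate ideal inside the free algebra on \<open>L\<close>.\<close>
  have "J L \<subseteq> J L' \<inter> J L"
  proof (rule enveloping_ideal_least)
    fix x y assume xy: "x \<in> L" "y \<in> L"
    then have xy': "x \<in> L'" "y \<in> L'" using sub by auto
    show "gen (x + y) - gen x - gen y \<in> J L' \<inter> J L"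
      using enveloping_ideal_relations(1)[OF L xy] enveloping_ideal_relations(1)[OF L' xy'] by blast
    show "gen x * gen y - gen y * gen x - gen (bracket x y) \<in> J L' \<inter> J L"
      using enveloping_ideal_relations(3)[OF L xy] enveloping_ideal_relations(3)[OF L' xy'] by blast
    show "gen (scale c x) - const c * gen x \<in> J L' \<inter> J L" for c
      using enveloping_ideal_relations(2)[OF L xy(1)] enveloping_ideal_relations(2)[OF L' xy'(1)]
      by blast
  qed (use J A in auto)
  then show ?thesis by blast
qed

text \<open>The principal anti-automorphism, which negates the elements of the Lie algebra.\<close>

definition antipode :: "('g free_monoid \<Rightarrow>\<^sub>0 'k) \<Rightarrow> ('g free_monoid \<Rightarrow>\<^sub>0 'k)" where
  "antipode = lift (\<lambda>w. const ((-1) ^ length w) * word (rev w))"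

lemma antipode_const: "antipode (const c * p) = const c * antipode p"
  and antipode_add: "antipode (p + q) = antipode p + antipode q"
  and antipode_diff: "antipode (p - q) = antipode p - antipode q"
  and antipode_gen: "antipode (gen x) = - gen x"
  by (simp_all add: antipode_def lift_scale lift_add lift_diff gen_eq_word const_uminus)

lemma antipode_0: "antipode 0 = 0"
  by (simp add: antipode_def)

lemma antipode_word_mult: "antipode (word u * word v) = antipode (word v) * antipode (word u)"
proof -
  have "antipode (word u * word v) =
      const ((-1) ^ length v * (-1) ^ length u) * (word (rev v) * word (rev u))"
    by (simp add: antipode_def power_add mult.commute flip: word_append)
  also have "\<dots> = const ((-1) ^ length v) * (const ((-1) ^ length u) * (word (rev v) * word (rev u)))"
    by (simp add: const_mult flip: mult.assoc)
  also have "const ((-1) ^ length u) * (word (rev v) * word (rev u)) =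
      word (rev v) * (const ((-1) ^ length u) * word (rev u))"
    by (rule const_left_commute[symmetric])
  finally show ?thesis
    by (simp add: antipode_def mult.assoc)
qed

lemma antipode_mult: "antipode (p * q) = antipode q * antipode p"
proof (induction p rule: free_algebra_UNIV_induct)
  case (word u)
  show ?case
  proof (induction q rule: free_algebra_UNIV_induct)
    case (scale c q)
    then show ?case
      by (simp add: antipode_const const_left_commute[of "word u"] mult.assoc)
  qed (simp_all add: antipode_0 antipode_add antipode_word_mult distrib_left distrib_right)
next
  case (scale c p)
  then show ?case
    by (simp add: antipode_const const_left_commute[of "antipode q"] mult.assoc)
qed (simp_all add: antipode_0 antipode_add distrib_left distrib_right)

lemma antipode_in_free_algebra: "p \<in> A L \<Longrightarrow> antipode p \<in> A L"
  unfolding antipode_def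
  by (rule lift_in_subspace[OF _ subspace_free_algebra])
    (auto intro!: scale_in_free_algebra word_in_free_algebra)

lemma antipode_antipode: "antipode (antipode p) = p"
proof (induction p rule: free_algebra_UNIV_induct)
  case (word w)
  have "(-1) ^ length w * (-1) ^ length w = (1 :: 'k)"
    by (simp flip: power_add mult_2)
  then show ?case
    by (simp add: antipode_def lift_scale const_mult flip: mult.assoc)
qed (simp_all add: antipode_def lift_add lift_scale)

lemma antipode_enveloping_ideal:
  assumes L: "liesub L"
  shows "antipode ` J L \<subseteq> J L"
proof -
  note J = enveloping_ideal_closed[OF L]
  have br: "\<And>x y. x \<in> L \<Longrightarrow> y \<in> L \<Longrightarrow> bracket x y \<in> L" and sub: "subspace L"
    using L by (auto simp: lie_subalgebra_def)
  have "J L \<subseteq> J L \<inter> {p. antipode p \<in> J L}"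
  proof (rule enveloping_ideal_least)
    fix x y assume xy: "x \<in> L" "y \<in> L"
    have "antipode (gen x * gen y - gen y * gen x - gen (bracket x y)) =
        - (gen x * gen y - gen y * gen x - gen (bracket x y))"
      by (simp add: antipode_diff antipode_mult antipode_gen)
    then show "gen x * gen y - gen y * gen x - gen (bracket x y) \<in> J L \<inter> {p. antipode p \<in> J L}"
      using enveloping_ideal_relations(3)[OF L xy] J(7) by (metis Int_iff mem_Collect_eq)
    have "antipode (gen (x + y) - gen x - gen y) = - (gen (x + y) - gen x - gen y)"
      by (simp add: antipode_diff antipode_gen)
    then show "gen (x + y) - gen x - gen y \<in> J L \<inter> {p. antipode p \<in> J L}"
      using enveloping_ideal_relations(1)[OF L xy] J(7) by (metis Int_iff mem_Collect_eq)
  next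
    fix c x assume x: "x \<in> L"
    have "antipode (gen (scale c x) - const c * gen x) = - (gen (scale c x) - const c * gen x)"
      by (simp add: antipode_diff antipode_gen antipode_const)
    then show "gen (scale c x) - const c * gen x \<in> J L \<inter> {p. antipode p \<in> J L}"
      using enveloping_ideal_relations(2)[OF L x] J(7) by (metis Int_iff mem_Collect_eq)
  qed (use J in \<open>auto simp: antipode_add antipode_mult antipode_in_free_algebra antipode_def[THEN fun_cong, of 0]\<close>)
  then show ?thesis by blast
qed

lemma noetherian_iff_left_noetherian:
  assumes L: "liesub L"
  shows "noetherian (enveloping_algebra scale bracket L) \<longleftrightarrow>
    left_noetherian (enveloping_algebra scale bracket L)"
proof -
  have "anti_involution (free_algebra L) antipode"
    by (simp add: anti_involution_def antipode_in_free_algebra antipode_antipode antipode_add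
        antipode_mult)
  then have "anti_involution (enveloping_algebra scale bracket L) ((`) antipode)"
    unfolding enveloping_algebra_def
    by (rule ideal.anti_involution_quotient[OF ideal_enveloping_ideal[OF L]])
      (rule antipode_enveloping_ideal[OF L])
  then show ?thesis
    using ring.left_noetherian_iff_right_noetherian[OF ring_enveloping_algebra[OF L]]
    by (simp add: noetherian_def)
qed

text \<open>A left ideal of \<open>U(L)\<close>, replaced by its preimage in the free algebra.\<close>

definition env_left_ideal :: "'g set \<Rightarrow> ('g free_monoid \<Rightarrow>\<^sub>0 'k) set \<Rightarrow> bool" where
  "env_left_ideal L I \<longleftrightarrow> J L \<subseteq> I \<and> I \<subseteq> A L \<and> (\<forall>p\<in>I. \<forall>q\<in>I. p + q \<in> I) \<and>
     (\<forall>a\<in>A L. \<forall>p\<in>I. a * p \<in> I)"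

lemma noetherian_enveloping_algebra_iff:
  assumes L: "liesub L"
  shows "noetherian (enveloping_algebra scale bracket L) \<longleftrightarrow>
    (\<forall>I :: nat \<Rightarrow> _. (\<forall>n. env_left_ideal L (I n)) \<and> (\<forall>n. I n \<subseteq> I (Suc n)) \<longrightarrow>
      (\<exists>N. \<forall>n\<ge>N. I n = I N))"
proof -
  have "left_ideal K (free_algebra L) \<and> J L \<subseteq> K \<longleftrightarrow> env_left_ideal L K" for K
    using enveloping_ideal_closed(2)[OF L]
    by (auto simp: ring.left_ideal_iff[OF ring_free_algebra] env_left_ideal_def)
  then show ?thesis
    unfolding noetherian_iff_left_noetherian[OF L]
    by (simp add: enveloping_algebra_def ideal.left_noetherian_quotient_iff[OF ideal_enveloping_ideal[OF L]])
qed

end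

section \<open>Straightening words in an ordered basis\<close>

text \<open>The order is a strict linear order on all elements, not only on the basis. Words with letters
  outside \<open>B\<close> are then straightened by the same recursion, and the swap rules below hold for all
  words, wherever their letters come from.\<close>

locale ordered_basis_lie_algebra = lie_algebra scale bracket
  for scale :: "'k::field \<Rightarrow> 'g::ab_group_add \<Rightarrow> 'g" and bracket :: "'g \<Rightarrow> 'g \<Rightarrow> 'g" +
  fixes B :: "'g set" and lt :: "'g \<Rightarrow> 'g \<Rightarrow> bool"
  assumes independent_B: "independent B" and span_B: "span B = UNIV"
    and lt_irrefl: "\<not> lt x x"
    and lt_trans: "lt x y \<Longrightarrow> lt y z \<Longrightarrow> lt x z"
    and lt_total: "x \<noteq> y \<Longrightarrow> lt x y \<or> lt y x"
begin

abbreviation coord :: "'g \<Rightarrow> 'g \<Rightarrow> 'k" where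
  "coord \<equiv> representation B"

text \<open>The linear extension to the Lie algebra of a function on the basis \<open>B\<close>.\<close>

definition linext :: "('g \<Rightarrow> ('g free_monoid \<Rightarrow>\<^sub>0 'k)) \<Rightarrow> 'g \<Rightarrow> ('g free_monoid \<Rightarrow>\<^sub>0 'k)" where
  "linext f x = (\<Sum>c | coord x c \<noteq> 0. const (coord x c) * f c)"

lemma linext_cong [fundef_cong]:
  "x = y \<Longrightarrow> (\<And>c. coord y c \<noteq> 0 \<Longrightarrow> f c = g c) \<Longrightarrow> linext f x = linext g y"
  unfolding linext_def by (auto intro: sum.cong)

lemma linext_superset:
  assumes "finite S" "{c. coord x c \<noteq> 0} \<subseteq> S"
  shows "linext f x = (\<Sum>c\<in>S. const (coord x c) * f c)"
  unfolding linext_def using assms by (intro sum.mono_neutral_left) auto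

lemma linext_add: "linext f (x + y) = linext f x + linext f y"
proof -
  let ?S = "{c. coord x c \<noteq> 0} \<union> {c. coord y c \<noteq> 0}"
  have fin: "finite ?S" by (simp add: finite_representation)
  have coord: "coord (x + y) c = coord x c + coord y c" for c
    using representation_add[OF independent_B, of y x] by (simp add: span_B add.commute)
  have "linext f z = (\<Sum>c\<in>?S. const (coord z c) * f c)" if "{c. coord z c \<noteq> 0} \<subseteq> ?S" for z
    using linext_superset[OF fin that] .
  moreover have "{c. coord (x + y) c \<noteq> 0} \<subseteq> ?S" by (auto simp: coord)
  ultimately show ?thesis
    by (simp add: coord const_add distrib_right sum.distrib)
qed

lemma linext_scale: "linext f (scale r x) = const r * linext f x"
proof -
  have coord: "coord (scale r x) c = r * coord x c" for c
    using representation_scale[OF independent_B] by (simp add: span_B)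
  have "linext f (scale r x) = (\<Sum>c | coord x c \<noteq> 0. const (coord (scale r x) c) * f c)"
    by (rule linext_superset) (auto simp: finite_representation coord)
  then show ?thesis
    by (simp add: coord linext_def sum_distrib_left const_mult flip: mult.assoc)
qed

lemma linext_0 [simp]: "linext f 0 = 0"
  using linext_scale[of f 0 0] by simp

lemma linext_uminus: "linext f (- x) = - linext f x"
  using linext_scale[of f "-1" x] by (simp add: const_uminus)

lemma linext_fun_diff: "linext (\<lambda>c. f c - g c) x = linext f x - linext g x"
  by (simp add: linext_def right_diff_distrib sum_subtractf)

lemma linext_mult_left: "p * linext f x = linext (\<lambda>c. p * f c) x"
  by (simp add: linext_def sum_distrib_left const_left_commute)

lemma linext_mult_right: "linext f x * p = linext (\<lambda>c. f c * p) x"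
  by (simp add: linext_def sum_distrib_right mult.assoc)

lemma lift_linext: "lift F (linext f x) = linext (\<lambda>c. lift F (f c)) x"
  by (simp add: linext_def lift_sum lift_scale)

text \<open>Two brackets at distant places of a word may be expanded in either order.\<close>

lemma linext_swap: "linext (\<lambda>c. linext (f c) y) x = linext (\<lambda>d. linext (\<lambda>c. f c d) x) y"
proof -
  have "const a * (const b * p) = const b * (const a * p)" for a b :: 'k and p :: "'g free_monoid \<Rightarrow>\<^sub>0 'k"
    by (simp add: const_mult mult.commute flip: mult.assoc)
  then show ?thesis
    unfolding linext_def sum_distrib_left
    by (subst sum.swap) (auto intro!: sum.cong)
qed

lemma sum_coord: "(\<Sum>c | coord x c \<noteq> 0. scale (coord x c) c) = x"
  by (rule sum_nonzero_representation_eq) (simp_all add: independent_B span_B)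

lemma linext_linear:
  assumes add: "\<And>x y. f (x + y) = f x + f y" and sc: "\<And>r x. f (scale r x) = const r * f x"
  shows "linext f x = f x"
proof -
  have "f 0 = 0" using sc[of 0 0] by simp
  then have "f (\<Sum>c\<in>S. scale (coord x c) c) = (\<Sum>c\<in>S. const (coord x c) * f c)" for S
    by (induction S rule: infinite_finite_induct) (simp_all add: add sc)
  from this[of "{c. coord x c \<noteq> 0}"] show ?thesis
    by (simp add: linext_def sum_coord)
qed

lemma linext_basis:
  assumes "c \<in> B"
  shows "linext f c = f c"
proof -
  have "{d. coord c d \<noteq> 0} = {c}" "coord c c = 1"
    by (auto simp: representation_basis[OF independent_B assms])
  then show ?thesis by (simp add: linext_def)
qed

fun inversions :: "'g list \<Rightarrow> nat" where
  "inversions [] = 0"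
| "inversions (a # w) = length (filter (\<lambda>b. lt b a) w) + inversions w"

lemma inversions_swap:
  assumes "lt b a"
  shows "inversions (u @ b # a # v) < inversions (u @ a # b # v)"
  using assms lt_trans[of a b a] lt_irrefl by (induction u) auto

abbreviation nondecreasing :: "'g list \<Rightarrow> bool" where
  "nondecreasing \<equiv> sorted_wrt (\<lambda>a b. \<not> lt b a)"

text \<open>Transitivity of the order turns some inversion into one between neighbours.\<close>

lemma ex_inversion:
  assumes "\<not> nondecreasing w"
  shows "\<exists>s. case s of (u, a, b, v) \<Rightarrow> w = u @ a # b # v \<and> lt b a"
  using assms
proof (induction w)
  case (Cons a w)
  show ?case
  proof (cases "nondecreasing w")
    case False
    then obtain u c b v where "w = u @ c # b # v" "lt b c" using Cons.IH by auto
    then have "a # w = (a # u) @ c # b # v \<and> lt b c" by simp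
    then show ?thesis by (intro exI[of _ "(a # u, c, b, v)"]) simp
  next
    case True
    then obtain x where x: "x \<in> set w" "lt x a" using Cons.prems by auto
    then obtain b w' where w: "w = b # w'" by (cases w) auto
    have "lt b a"
      using x True lt_total lt_trans unfolding w by (cases "x = b") (auto, metis)
    then show ?thesis using w by (intro exI[of _ "([], a, b, w')"]) simp
  qed
qed simp

definition pick_inversion :: "'g list \<Rightarrow> 'g list \<times> 'g \<times> 'g \<times> 'g list" where
  "pick_inversion w = (SOME s. case s of (u, a, b, v) \<Rightarrow> w = u @ a # b # v \<and> lt b a)"

lemma pick_inversion:
  assumes "\<not> nondecreasing w" "pick_inversion w = (u, a, b, v)"
  shows "w = u @ a # b # v" "lt b a"
  using someI_ex[OF ex_inversion[OF assms(1)]] assms(2) by (auto simp: pick_inversion_def)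

lemma pick_inversion_decreases:
  assumes "\<not> nondecreasing w" "(u, a, b, v) = pick_inversion w"
  shows "length w = length u + length v + 2 \<and> inversions (u @ b # a # v) < inversions w"
  using pick_inversion[OF assms(1) assms(2)[symmetric]] inversions_swap by auto

text \<open>Normal forms modulo \<open>xy - yx - [x, y]\<close>: repair an arbitrarily chosen inversion of neighbours,
  at the cost of a shorter word that contains the bracket. Independence of the choice is the content
  of the Poincare-Birkhoff-Witt theorem and is proved below as \<open>swap_rule\<close>.\<close>

function straighten :: "'g list \<Rightarrow> ('g free_monoid \<Rightarrow>\<^sub>0 'k)" where
  "straighten w =
    (if nondecreasing w then word w
     else case pick_inversion w of (u, a, b, v) \<Rightarrow>
       straighten (u @ b # a # v) + linext (\<lambda>c. straighten (u @ c # v)) (bracket a b))"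
  by pat_completeness auto
termination
  by (relation "measures [length, inversions]") (auto dest!: pick_inversion_decreases)

declare straighten.simps [simp del]

lemma straighten_nondecreasing: "nondecreasing w \<Longrightarrow> straighten w = word w"
  by (simp add: straighten.simps)

abbreviation insert_bracket :: "'g list \<Rightarrow> 'g \<Rightarrow> 'g list \<Rightarrow> ('g free_monoid \<Rightarrow>\<^sub>0 'k)" where
  "insert_bracket u x v \<equiv> linext (\<lambda>c. straighten (u @ c # v)) x"

lemma linext_bracket_left: "linext (\<lambda>c. linext f (bracket c y)) x = linext f (bracket x y)"
  by (rule linext_linear) (simp_all add: bracket_add_left bracket_scale_left linext_add linext_scale)

lemma linext_bracket_right: "linext (\<lambda>c. linext f (bracket y c)) x = linext f (bracket y x)"
  by (rule linext_linear) (simp_all add: bracket_add_right bracket_scale_right linext_add linext_scale)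

text \<open>Every inversion of \<open>w\<close>, and not only the chosen one, may be repaired first.\<close>

definition swap_rule :: "'g list \<Rightarrow> bool" where
  "swap_rule w \<longleftrightarrow> (\<forall>u a b v. w = u @ a # b # v \<longrightarrow> lt b a \<longrightarrow>
     straighten w = straighten (u @ b # a # v) + insert_bracket u (bracket a b) v)"

lemma swap_ruleD:
  assumes "swap_rule (u @ a # b # v)" "lt b a"
  shows "straighten (u @ a # b # v) = straighten (u @ b # a # v) + insert_bracket u (bracket a b) v"
  using assms unfolding swap_rule_def by blast

text \<open>A pair in the right order is an inversion after swapping, and the bracket is alternating; so the
  rule extends to arbitrary neighbours when both words satisfy it.\<close>

lemma swap_rule_diff:
  assumes "swap_rule (u @ a # b # v)" "swap_rule (u @ b # a # v)"
  shows "straighten (u @ a # b # v) - straighten (u @ b # a # v) = insert_bracket u (bracket a b) v"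
proof -
  consider "a = b" | "lt b a" | "lt a b" using lt_total by blast
  then show ?thesis
  proof cases
    case 3
    then show ?thesis
      using swap_ruleD[OF assms(2) 3] bracket_antisym[of b a] by (simp add: linext_uminus)
  qed (use swap_ruleD[OF assms(1)] bracket_self in simp_all)
qed

text \<open>Two inversions without a common letter: repairing both, in either order, leads to the same word.
  The correction term of one pair, taken before and after repairing the other, changes by the words in
  which both pairs are replaced by their brackets, and this double correction is symmetric.\<close>

lemma swap_disjoint:
  assumes short: "\<And>w. length w < length (u @ a # b # m @ c # d # v) \<Longrightarrow> swap_rule w"
    and "swap_rule (u @ b # a # m @ c # d # v)" "swap_rule (u @ a # b # m @ d # c # v)"
    and "lt b a" "lt d c"
  shows "straighten (u @ b # a # m @ c # d # v) + insert_bracket u (bracket a b) (m @ c # d # v) =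
    straighten (u @ a # b # m @ d # c # v) + insert_bracket (u @ a # b # m) (bracket c d) v"
proof -
  have 1: "straighten (u @ b # a # m @ c # d # v) =
      straighten (u @ b # a # m @ d # c # v) + insert_bracket (u @ b # a # m) (bracket c d) v"
    using swap_ruleD[of "u @ b # a # m" c d v] assms by simp
  have 2: "straighten (u @ a # b # m @ d # c # v) =
      straighten (u @ b # a # m @ d # c # v) + insert_bracket u (bracket a b) (m @ d # c # v)"
    using swap_ruleD[of u a b "m @ d # c # v"] assms by simp
  have "insert_bracket u (bracket a b) (m @ c # d # v) - insert_bracket u (bracket a b) (m @ d # c # v) =
      linext (\<lambda>e. insert_bracket (u @ e # m) (bracket c d) v) (bracket a b)"
    using swap_rule_diff[OF short short, of "u @ e # m" c d v for e]
    by (simp flip: linext_fun_diff)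
  also have "\<dots> = linext (\<lambda>f. insert_bracket u (bracket a b) (m @ f # v)) (bracket c d)"
    by (simp add: linext_swap[of _ "bracket c d"])
  also have "\<dots> = insert_bracket (u @ a # b # m) (bracket c d) v -
      insert_bracket (u @ b # a # m) (bracket c d) v"
    using swap_rule_diff[OF short short, of u a b "m @ f # v" for f]
    by (simp flip: linext_fun_diff)
  finally show ?thesis
    unfolding 1 2 by (simp add: algebra_simps)
qed

text \<open>Inversions \<open>a b\<close> and \<open>b c\<close> with a common letter: both ways of sorting \<open>a b c\<close> end in \<open>c b a\<close>, and
  the correction terms agree by the Jacobi identity.\<close>

lemma swap_overlap:
  assumes short: "\<And>w. length w < length (u @ a # b # c # v) \<Longrightarrow> swap_rule w"
    and rules: "swap_rule (u @ b # a # c # v)" "swap_rule (u @ b # c # a # v)"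
      "swap_rule (u @ a # c # b # v)" "swap_rule (u @ c # a # b # v)"
    and lt: "lt b a" "lt c b"
  shows "straighten (u @ b # a # c # v) + insert_bracket u (bracket a b) (c # v) =
    straighten (u @ a # c # b # v) + insert_bracket (u @ [a]) (bracket b c) v"
proof -
  have ca: "lt c a" using lt lt_trans by blast
  have 1: "straighten (u @ b # a # c # v) = straighten (u @ c # b # a # v) +
      insert_bracket u (bracket b c) (a # v) + insert_bracket (u @ [b]) (bracket a c) v"
    using swap_ruleD[of "u @ [b]" a c v] swap_ruleD[of u b c "a # v"] rules lt ca by simp
  have 2: "straighten (u @ a # c # b # v) = straighten (u @ c # b # a # v) +
      insert_bracket (u @ [c]) (bracket a b) v + insert_bracket u (bracket a c) (b # v)"
    using swap_ruleD[of "u @ [c]" a b v] swap_ruleD[of u a c "b # v"] rules lt ca by simp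
  \<comment> \<open>Moving \<open>y\<close> across a bracket \<open>x\<close> produces the double bracket; the three of them cancel.\<close>
  have move: "insert_bracket u x (y # v) - insert_bracket (u @ [y]) x v =
      insert_bracket u (bracket x y) v" for x y
  proof -
    have "insert_bracket u x (y # v) - insert_bracket (u @ [y]) x v =
        linext (\<lambda>e. insert_bracket u (bracket e y) v) x"
      using swap_rule_diff[OF short short, of u e y v for e]
      by (simp flip: linext_fun_diff)
    then show ?thesis by (simp add: linext_bracket_left)
  qed
  have jac: "bracket (bracket a b) c + bracket (bracket b c) a - bracket (bracket a c) b = 0"
  proof -
    have "bracket b (bracket a c) = - bracket b (bracket c a)"
      using bracket_scale_right[of b "-1" "bracket c a"] by (simp add: bracket_antisym[of c a])
    then show ?thesis
      using jacobi[of a b c] bracket_antisym[of c "bracket a b"] bracket_antisym[of a "bracket b c"]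
        bracket_antisym[of b "bracket a c"]
      by (simp add: algebra_simps)
  qed
  have "insert_bracket u (bracket (bracket a b) c) v + insert_bracket u (bracket (bracket b c) a) v
      - insert_bracket u (bracket (bracket a c) b) v = 0"
    using arg_cong[OF jac, of "\<lambda>x. insert_bracket u x v"]
    by (simp add: linext_add linext_uminus diff_conv_add_uminus del: add_uminus_conv_diff)
  then show ?thesis
    unfolding 1 2 using move[where x = "bracket a b" and y = c] move[where x = "bracket b c" and y = a] move[where x = "bracket a c" and y = b]
    by (simp add: algebra_simps)
qed

text \<open>Induction on the length and then on the number of inversions: repairing one of two inversions
  produces words for which the rule is known, so the two lemmas above compare the results.\<close>

lemma swap_rule: "swap_rule w"
proof (induction w rule: wf_induct_rule[OF wf_measures[of "[length, inversions]"]])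
  case (1 w)
  have short: "swap_rule w'" if "length w' < length w" for w'
    using 1 that by simp
  have fewer: "swap_rule w'" if "length w' = length w" "inversions w' < inversions w" for w'
    using 1 that by simp
  have confluent: "straighten (u @ b # a # v) + insert_bracket u (bracket a b) v =
      straighten (u @ us @ b' # a' # v') + insert_bracket (u @ us) (bracket a' b') v'"
    if w: "w = u @ a # b # v" and eq: "a # b # v = us @ a' # b' # v'" and lt: "lt b a" "lt b' a'"
    for u a b v us a' b' v'
  proof -
    consider "us = []" | "us = [a]" "a' = b" "v = b' # v'" | m where "us = a # b # m" "v = m @ a' # b' # v'"
      using eq by (cases us rule: list.exhaust; cases "tl us") auto
    then show ?thesis
    proof cases
      case 1
      then show ?thesis using eq by simp
    next
      case 2
      have "inversions (u @ b # a # b' # v') < inversions w"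
        "inversions (u @ b # b' # a # v') < inversions (u @ b # a # b' # v')"
        "inversions (u @ a # b' # b # v') < inversions w"
        "inversions (u @ b' # a # b # v') < inversions (u @ a # b' # b # v')"
        using lt 2 inversions_swap[of b a u "b' # v'"] inversions_swap[of b' a "u @ [b]" v']
          inversions_swap[of b' b "u @ [a]" v'] inversions_swap[of b' a u "b # v'"]
          lt_trans[of b' b a] by (auto simp: w)
      then show ?thesis
        using swap_overlap[of u a b b' v'] lt 2 short fewer by (simp add: w)
    next
      case 3
      then show ?thesis
        using swap_disjoint[of u a b m a' b' v'] lt short fewer
          inversions_swap[of b a u "m @ a' # b' # v'"] inversions_swap[of b' a' "u @ a # b # m" v']
        by (simp add: w)
    qed
  qed
  show ?case
    unfolding swap_rule_def
  proof (intro allI impI)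
    fix u a b v
    assume w: "w = u @ a # b # v" and lt: "lt b a"
    have inv: "\<not> nondecreasing w" using w lt by (auto simp: sorted_wrt_append)
    obtain u' a' b' v' where p: "pick_inversion w = (u', a', b', v')" by (metis surj_pair)
    note w' = pick_inversion[OF inv p]
    have nf: "straighten w = straighten (u' @ b' # a' # v') + insert_bracket u' (bracket a' b') v'"
      using inv p by (subst straighten.simps) simp
    have "u @ a # b # v = u' @ a' # b' # v'" using w w' by simp
    from this[unfolded append_eq_append_conv2]
    obtain us where "u = u' @ us \<and> us @ a # b # v = a' # b' # v' \<or>
        u @ us = u' \<and> a # b # v = us @ a' # b' # v'"
      by (rule exE)
    then show "straighten w = straighten (u @ b # a # v) + insert_bracket u (bracket a b) v"
    proof
      assume us: "u = u' @ us \<and> us @ a # b # v = a' # b' # v'"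
      have "straighten (u' @ b' # a' # v') + insert_bracket u' (bracket a' b') v' =
          straighten (u' @ us @ b # a # v) + insert_bracket (u' @ us) (bracket a b) v"
        by (rule confluent[OF w'(1) _ w'(2) lt]) (use us in simp)
      then show ?thesis unfolding nf using us by simp
    next
      assume us: "u @ us = u' \<and> a # b # v = us @ a' # b' # v'"
      have "straighten (u @ b # a # v) + insert_bracket u (bracket a b) v =
          straighten (u @ us @ b' # a' # v') + insert_bracket (u @ us) (bracket a' b') v'"
        by (rule confluent[OF w _ lt w'(2)]) (use us in simp)
      then show ?thesis unfolding nf using conjunct1[OF us, symmetric] by simp
    qed
  qed
qed

lemma straighten_swap:
  "straighten (u @ a # b # v) - straighten (u @ b # a # v) = insert_bracket u (bracket a b) v"
  by (rule swap_rule_diff) (rule swap_rule)+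

end

section \<open>Normal forms and the projection onto a subalgebra\<close>

context ordered_basis_lie_algebra
begin

text \<open>Substituting for every letter its coordinate expansion imposes the linear relations of
  \<open>U(L)\<close>, so that straightening has to deal with the commutator relations only.\<close>

definition expand :: "('g free_monoid \<Rightarrow>\<^sub>0 'k) \<Rightarrow> ('g free_monoid \<Rightarrow>\<^sub>0 'k)" where
  "expand = lift (\<lambda>w. prod_list (map (linext gen) w))"

lemma expand_mult: "expand (p * q) = expand p * expand q"
  unfolding expand_def by (rule lift_mult) simp

lemma expand_gen: "expand (gen x) = linext gen x"
  by (simp add: expand_def gen_eq_word)

lemma expand_scale: "expand (const c * p) = const c * expand p"
  and expand_add: "expand (p + q) = expand p + expand q"
  and expand_diff: "expand (p - q) = expand p - expand q"
  and expand_0: "expand 0 = 0"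
  and expand_1: "expand 1 = 1"
  by (simp_all add: expand_def lift_scale lift_add lift_diff flip: word_Nil)

definition normal_form :: "('g free_monoid \<Rightarrow>\<^sub>0 'k) \<Rightarrow> ('g free_monoid \<Rightarrow>\<^sub>0 'k)" where
  "normal_form p = lift straighten (expand p)"

lemma normal_form_scale: "normal_form (const c * p) = const c * normal_form p"
  and normal_form_add: "normal_form (p + q) = normal_form p + normal_form q"
  and normal_form_diff: "normal_form (p - q) = normal_form p - normal_form q"
  and normal_form_0: "normal_form 0 = 0"
  by (simp_all add: normal_form_def expand_scale expand_add expand_diff expand_0
      lift_scale lift_add lift_diff)

text \<open>By bilinearity this is the swap rule for pairs of basis elements.\<close>

lemma straighten_commutator:
  "lift straighten (p * (linext gen x * linext gen y - linext gen y * linext gen x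
     - linext gen (bracket x y)) * q) = 0"
proof (induction p rule: free_algebra_UNIV_induct)
  case (word u)
  show ?case
  proof (induction q rule: free_algebra_UNIV_induct)
    case (word v)
    have two: "word u * (linext gen a * linext gen b) * word v =
        linext (\<lambda>c. linext (\<lambda>d. word (u @ c # d # v)) b) a" for a b
      by (simp add: linext_mult_left linext_mult_right word_append word_Cons mult.assoc
          linext_swap[where y = a and x = b])
    have one: "word u * linext gen a * word v = linext (\<lambda>c. word (u @ c # v)) a" for a
      by (simp add: linext_mult_left linext_mult_right word_append word_Cons mult.assoc)
    have "lift straighten (word u * (linext gen x * linext gen y) * word v) -
        lift straighten (word u * (linext gen y * linext gen x) * word v) =
        linext (\<lambda>c. linext (\<lambda>d. straighten (u @ c # d # v) - straighten (u @ d # c # v)) y) x"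
      by (simp only: two lift_linext lift_word linext_fun_diff linext_swap[of _ x y])
    also have "\<dots> = insert_bracket u (bracket x y) v"
      by (simp add: straighten_swap linext_bracket_left linext_bracket_right)
    also have "\<dots> = lift straighten (word u * linext gen (bracket x y) * word v)"
      by (simp only: one lift_linext lift_word)
    finally show ?case
      by (simp add: right_diff_distrib left_diff_distrib lift_diff)
  qed (simp_all add: distrib_left lift_add const_left_commute lift_scale)
qed (simp_all add: distrib_right lift_add mult.assoc lift_scale)

text \<open>Together with \<open>normal_form_cong\<close> this is the Poincare-Birkhoff-Witt theorem: normal forms exist
  modulo the relations, and elements of the ideal have normal form 0; as nondecreasing words in the
  basis are their own normal forms, they are linearly independent modulo the ideal.\<close>

lemma normal_form_enveloping_ideal:
  assumes "p \<in> J UNIV"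
  shows "normal_form p = 0"
proof -
  have "J UNIV \<subseteq> {p. \<forall>a b. normal_form (a * p * b) = 0}"
  proof (rule enveloping_ideal_least)
    fix x y c
    have "linext gen (x + y) - linext gen x - linext gen y = 0"
      by (simp add: linext_add)
    then show "gen (x + y) - gen x - gen y \<in> {p. \<forall>a b. normal_form (a * p * b) = 0}"
      by (simp add: normal_form_def expand_mult expand_diff expand_gen)
    have "expand (gen (scale c x) - const c * gen x) = 0"
      by (simp add: expand_diff expand_scale expand_gen linext_scale)
    then show "gen (scale c x) - const c * gen x \<in> {p. \<forall>a b. normal_form (a * p * b) = 0}"
      by (simp add: normal_form_def expand_mult)
    show "gen x * gen y - gen y * gen x - gen (bracket x y)
        \<in> {p. \<forall>a b. normal_form (a * p * b) = 0}"
      by (simp add: normal_form_def expand_mult expand_diff expand_gen straighten_commutator)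
  qed (auto simp: distrib_left distrib_right normal_form_add normal_form_0 mult.assoc,
      simp_all flip: mult.assoc)
  from subsetD[OF this assms] have "normal_form (1 * p * 1) = 0" by blast
  then show ?thesis by simp
qed

lemma expand_basis_word:
  assumes "set w \<subseteq> B"
  shows "expand (word w) = word w"
  using assms
  by (induction w) (simp_all add: word_Nil word_Cons expand_1 expand_mult expand_gen linext_basis)

lemma normal_form_nondecreasing:
  assumes "set w \<subseteq> B" "nondecreasing w"
  shows "normal_form (word w) = word w"
  using assms by (simp add: normal_form_def expand_basis_word straighten_nondecreasing)

abbreviation normal_words :: "'g set \<Rightarrow> ('g free_monoid \<Rightarrow>\<^sub>0 'k) set" where
  "normal_words C \<equiv> FA.span (word ` {w. set w \<subseteq> C \<and> nondecreasing w})"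

lemma linext_in_subspace:
  "FA.subspace S \<Longrightarrow> (\<And>c. coord x c \<noteq> 0 \<Longrightarrow> f c \<in> S) \<Longrightarrow> linext f x \<in> S"
  unfolding linext_def by (auto intro!: FA.subspace_sum FA.subspace_scale)

text \<open>If \<open>C \<subseteq> B\<close> is a basis of the subalgebra \<open>L\<close>, reduction to normal form does not leave \<open>L\<close>:
  it changes an element of the free algebra on \<open>L\<close> only by relations of \<open>L\<close>. This is used for the
  given subalgebra and for the whole Lie algebra.\<close>

context
  fixes C L :: "'g set"
  assumes CB: "C \<subseteq> B" and C: "span C = L" and L: "liesub L"
begin

lemma coord_in: "x \<in> L \<Longrightarrow> coord x c \<noteq> 0 \<Longrightarrow> c \<in> C"
  using representation_extend[OF independent_B _ CB] representation_ne_zero C by metis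

lemma basis_subset: "C \<subseteq> L"
  using C span_superset by blast

lemma linext_gen_cong: "x \<in> L \<Longrightarrow> linext gen x - gen x \<in> J L"
proof -
  assume x: "x \<in> L"
  note J = enveloping_ideal_closed[OF L] enveloping_ideal_relations[OF L]
  have subL: "subspace L" using L by (simp add: lie_subalgebra_def)
  have zero: "gen 0 \<in> J L"
    using J(10)[of 0 0] subspace_0[OF subL] by simp
  have "(\<Sum>c\<in>S. scale (coord x c) c) \<in> L \<and>
      (\<Sum>c\<in>S. const (coord x c) * gen c) - gen (\<Sum>c\<in>S. scale (coord x c) c) \<in> J L"
    if "finite S" "S \<subseteq> L" for S
    using that
  proof (induction S)
    case empty
    then show ?case using J(7)[OF zero] subspace_0[OF subL] by simp
  next
    case (insert c S)
    let ?y = "\<Sum>c\<in>S. scale (coord x c) c" and ?z = "scale (coord x c) c"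
    have L': "?y \<in> L" "?z \<in> L" "c \<in> L" using insert subspace_scale[OF subL] by auto
    have "(\<Sum>c\<in>S. const (coord x c) * gen c) - gen ?y - (gen ?z - const (coord x c) * gen c)
        - (gen (?z + ?y) - gen ?z - gen ?y) \<in> J L"
      using insert J(8) J(9)[OF L'(2,1)] J(10)[OF L'(3)] by blast
    then show ?case
      using insert(1,2) L' subspace_add[OF subL] by (simp add: algebra_simps)
  qed
  from this[of "{c. coord x c \<noteq> 0}"] show ?thesis
    using coord_in[OF x] basis_subset by (auto simp: finite_representation linext_def sum_coord)
qed

lemma linext_gen_in: "x \<in> L \<Longrightarrow> linext gen x \<in> A C"
  by (rule linext_in_subspace[OF subspace_free_algebra]) (rule gen_in_free_algebra[OF coord_in])

lemma expand_word:
  assumes "set w \<subseteq> L"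
  shows "expand (word w) \<in> A C \<and> expand (word w) - word w \<in> J L"
  using assms
proof (induction w)
  case Nil
  then show ?case
    using word_in_free_algebra[of "[]" C] enveloping_ideal_closed(2)[OF L]
    by (simp add: expand_1 word_Nil)
next
  case (Cons x w)
  note J = enveloping_ideal_closed[OF L]
  have x: "x \<in> L" and IH: "expand (word w) \<in> A C" "expand (word w) - word w \<in> J L"
    using Cons by auto
  have eq: "expand (word (x # w)) = linext gen x * expand (word w)"
    by (simp add: word_Cons expand_mult expand_gen)
  have "(linext gen x - gen x) * expand (word w) + gen x * (expand (word w) - word w) \<in> J L"
    by (intro J(3-5) linext_gen_cong[OF x] gen_in_free_algebra[OF x] IH
        subsetD[OF free_algebra_mono[OF basis_subset]])
  then show ?case
    using free_algebra_closed(3)[OF linext_gen_in[OF x] IH(1)]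
    by (simp add: eq) (simp add: word_Cons algebra_simps)
qed

lemma straighten_cong: "set w \<subseteq> C \<Longrightarrow> straighten w - word w \<in> J L \<and> straighten w \<in> normal_words C"
proof (induction w rule: straighten.induct)
  case (1 w)
  note J = enveloping_ideal_closed[OF L]
  show ?case
  proof (cases "nondecreasing w")
    case True
    then show ?thesis
      using 1 J(2) by (auto simp: straighten_nondecreasing intro: FA.span_base)
  next
    case False
    obtain u a b v where p: "pick_inversion w = (u, a, b, v)" by (metis surj_pair)
    note w = pick_inversion[OF False p]
    have ab: "a \<in> L" "b \<in> L" and uv: "set u \<subseteq> L" "set v \<subseteq> L"
      using 1(3) w basis_subset by auto
    have br: "bracket a b \<in> L" using L ab by (simp add: lie_subalgebra_def)
    have IH1: "straighten (u @ b # a # v) - word (u @ b # a # v) \<in> J L"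
        "straighten (u @ b # a # v) \<in> normal_words C"
      using 1(1)[OF False p[symmetric]] 1(3) w by auto
    have IH2: "straighten (u @ c # v) - word (u @ c # v) \<in> J L"
        "straighten (u @ c # v) \<in> normal_words C" if "coord (bracket a b) c \<noteq> 0" for c
      using 1(2)[OF False p[symmetric] _ _ that] 1(3) w coord_in[OF br that] by auto
    have eq: "straighten w = straighten (u @ b # a # v) + insert_bracket u (bracket a b) v"
      using False p by (subst straighten.simps) simp
    have i: "linext (\<lambda>c. straighten (u @ c # v) - word (u @ c # v)) (bracket a b) \<in> J L"
      by (rule linext_in_subspace[OF subspace_enveloping_ideal[OF L]]) (rule IH2)
    have ii: "word u * (linext gen (bracket a b) - gen (bracket a b)) * word v \<in> J L"
      by (intro J(4,5) linext_gen_cong br word_in_free_algebra uv)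
    have iii: "word u * (gen a * gen b - gen b * gen a - gen (bracket a b)) * word v \<in> J L"
      by (intro J(4,5) enveloping_ideal_relations(3)[OF L] ab word_in_free_algebra uv)
    have wl: "word u * linext gen (bracket a b) * word v = linext (\<lambda>c. word (u @ c # v)) (bracket a b)"
      by (simp add: linext_mult_left linext_mult_right word_append word_Cons mult.assoc)
    have "straighten w - word w = (straighten (u @ b # a # v) - word (u @ b # a # v))
        + linext (\<lambda>c. straighten (u @ c # v) - word (u @ c # v)) (bracket a b)
        + word u * (linext gen (bracket a b) - gen (bracket a b)) * word v
        - word u * (gen a * gen b - gen b * gen a - gen (bracket a b)) * word v"
      unfolding eq linext_fun_diff right_diff_distrib left_diff_distrib wl
      by (simp add: w(1) word_append word_Cons mult.assoc)
    then have "straighten w - word w \<in> J L"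
      using J(3,8) IH1(1) i ii iii by presburger
    moreover have "straighten w \<in> normal_words C"
      unfolding eq
      by (intro FA.span_add IH1 linext_in_subspace[OF FA.subspace_span] IH2)
    ultimately show ?thesis ..
  qed
qed

lemma normal_form_cong:
  assumes p: "p \<in> A L"
  shows "normal_form p - p \<in> J L" "normal_form p \<in> normal_words C"
proof -
  note J = enveloping_ideal_closed[OF L]
  have 1: "expand p \<in> A C \<and> expand p - p \<in> J L"
    using p
  proof (induction rule: free_algebra_induct)
    case zero
    then show ?case using FA.subspace_0[OF subspace_free_algebra] J(2) by (simp add: expand_0)
  next
    case (add p q)
    have "expand (p + q) - (p + q) = (expand p - p) + (expand q - q)" by (simp add: expand_add)
    also have "\<dots> \<in> J L" using add J(3) by blast
    finally show ?case using add free_algebra_closed(1) by (auto simp: expand_add)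
  next
    case (scale c p)
    have "expand (const c * p) - const c * p = const c * (expand p - p)"
      by (simp add: expand_scale right_diff_distrib)
    also have "\<dots> \<in> J L" using scale J(6) by blast
    finally show ?case using scale scale_in_free_algebra by (auto simp: expand_scale)
  qed (rule expand_word)
  have 2: "lift straighten q - q \<in> J L \<and> lift straighten q \<in> normal_words C" if "q \<in> A C" for q
    using that
  proof (induction rule: free_algebra_induct)
    case zero
    then show ?case using J(2) FA.span_zero by simp
  next
    case (add p q)
    have "lift straighten (p + q) - (p + q) = (lift straighten p - p) + (lift straighten q - q)"
      by (simp add: lift_add)
    also have "\<dots> \<in> J L" using add J(3) by blast
    finally show ?case using add FA.span_add by (auto simp: lift_add)
  next
    case (scale c p)
    have "lift straighten (const c * p) - const c * p = const c * (lift straighten p - p)"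
      by (simp add: lift_scale right_diff_distrib)
    also have "\<dots> \<in> J L" using scale J(6) by blast
    finally show ?case using scale FA.span_scale by (auto simp: lift_scale)
  next
    case (word w)
    then show ?case using straighten_cong by simp
  qed
  have "normal_form p - p = (lift straighten (expand p) - expand p) + (expand p - p)"
    by (simp add: normal_form_def)
  then show "normal_form p - p \<in> J L" using 1 2 J(3) by metis
  show "normal_form p \<in> normal_words C" using 1 2 by (simp add: normal_form_def)
qed

end

text \<open>Now the basis \<open>H\<close> of \<open>L\<close> comes after all other elements. A nondecreasing word is then a
  word outside \<open>H\<close> followed by a word in \<open>H\<close>, and keeping those words whose first part is empty is
  the projection onto \<open>U(L)\<close>.\<close>

context
  fixes H L :: "'g set"
  assumes HB: "H \<subseteq> B" and H: "span H = L" and L: "liesub L"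
    and lt_H: "\<And>a b. a \<notin> H \<Longrightarrow> b \<in> H \<Longrightarrow> lt a b"
begin

definition keep :: "('g free_monoid \<Rightarrow>\<^sub>0 'k) \<Rightarrow> ('g free_monoid \<Rightarrow>\<^sub>0 'k)" where
  "keep = lift (\<lambda>w. if set w \<subseteq> H then word w else 0)"

lemma keep_scale: "keep (const c * p) = const c * keep p"
  and keep_add: "keep (p + q) = keep p + keep q"
  and keep_0: "keep 0 = 0"
  and keep_word: "keep (word w) = (if set w \<subseteq> H then word w else 0)"
  by (simp_all add: keep_def lift_scale lift_add)

lemma keep_in: "keep p \<in> A L"
  unfolding keep_def
  by (rule lift_in_subspace[OF free_algebra_UNIV subspace_free_algebra])
    (use basis_subset[OF HB H L] FA.subspace_0[OF subspace_free_algebra]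
      in \<open>auto intro!: word_in_free_algebra\<close>)

lemma keep_normal_words: "p \<in> normal_words H \<Longrightarrow> keep p = p"
proof (induction rule: FA.span_induct_alt)
  case (step c x y)
  then show ?case by (auto simp: keep_add keep_scale keep_word)
qed (rule keep_0)

lemma keep_normal_form:
  assumes "p \<in> A L"
  shows "keep (normal_form p) - p \<in> J L"
  using normal_form_cong[OF HB H L assms] keep_normal_words by simp

lemma normal_form_idem_left: "normal_form (normal_form a * y) = normal_form (a * y)"
proof -
  have U: "liesub UNIV" by (rule lie_subalgebra_UNIV)
  have "normal_form a - a \<in> J UNIV"
    by (rule normal_form_cong[OF order_refl span_B U]) simp
  then have "(normal_form a - a) * y \<in> J UNIV"
    using enveloping_ideal_closed(5)[OF U] by simp
  from normal_form_enveloping_ideal[OF this] show ?thesis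
    by (simp add: left_diff_distrib normal_form_diff)
qed

lemma split_nondecreasing:
  assumes "nondecreasing w"
  shows "set (dropWhile (\<lambda>x. x \<notin> H) w) \<subseteq> H"
  using assms
proof (induction w)
  case (Cons x w)
  show ?case
  proof (cases "x \<in> H")
    case True
    then have "y \<in> H" if "y \<in> set w" for y
      using Cons.prems that lt_H[of y x] by auto
    then show ?thesis using True by auto
  qed (use Cons in auto)
qed simp

text \<open>Right multiplication by an element of \<open>U(L)\<close> only affects the part of the word in \<open>H\<close>; the part
  outside \<open>H\<close> stays in front and remains sorted, so it decides before and after whether the
  term is kept.\<close>

lemma keep_normal_form_word:
  assumes w: "set w \<subseteq> B" "nondecreasing w" and y: "y \<in> A L"
  shows "keep (normal_form (word w * y)) - keep (word w) * y \<in> J L"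
proof -
  note J = enveloping_ideal_closed[OF L]
  have U: "liesub UNIV" by (rule lie_subalgebra_UNIV)
  define zs hs where "zs = takeWhile (\<lambda>x. x \<notin> H) w" and "hs = dropWhile (\<lambda>x. x \<notin> H) w"
  have w_eq: "w = zs @ hs" by (simp add: zs_def hs_def)
  have hs: "set hs \<subseteq> H" unfolding hs_def by (rule split_nondecreasing[OF w(2)])
  have zs: "set zs \<inter> H = {}" unfolding zs_def by (auto dest: set_takeWhileD)
  have hy: "word hs * y \<in> A L"
    by (intro free_algebra_closed(3) word_in_free_algebra y) (use hs basis_subset[OF HB H L] in blast)
  show ?thesis
  proof (cases "zs = []")
    case True
    then show ?thesis
      using hs keep_normal_form[OF hy] by (simp add: w_eq keep_word)
  next
    case False
    \<comment> \<open>A normal word in \<open>H\<close> remains normal after prefixing \<open>zs\<close>, and is then discarded.\<close>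
    have zero: "keep (normal_form (word zs * q)) = 0" if "q \<in> normal_words H" for q
      using that
    proof (induction rule: FA.span_induct_alt)
      case base
      then show ?case by (simp add: normal_form_0 keep_0)
    next
      case (step c x q)
      then obtain t where t: "x = word t" "set t \<subseteq> H" "nondecreasing t" by blast
      have "\<not> lt b a" if "a \<in> set zs" "b \<in> set t" for a b
        using that zs t lt_H[of a b] lt_trans[of a b a] lt_irrefl by blast
      then have "nondecreasing (zs @ t)" "set (zs @ t) \<subseteq> B"
        using t w HB by (auto simp: sorted_wrt_append w_eq)
      then have "normal_form (word zs * x) = word (zs @ t)"
        using normal_form_nondecreasing[of "zs @ t"] by (simp add: t(1) word_append)
      moreover have "\<not> set (zs @ t) \<subseteq> H" using zs False by (cases zs) auto
      ultimately have "keep (normal_form (word zs * x)) = 0"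
        by (simp only: keep_word if_False)
      then show ?case
        using step by (simp add: distrib_left const_left_commute normal_form_add normal_form_scale
            keep_add keep_scale)
    qed
    let ?q = "normal_form (word hs * y)"
    have "?q - word hs * y \<in> J UNIV"
      using normal_form_cong(1)[OF HB H L hy] enveloping_ideal_mono[OF L U] by blast
    then have "word zs * (?q - word hs * y) \<in> J UNIV"
      using enveloping_ideal_closed(4)[OF U] by simp
    from normal_form_enveloping_ideal[OF this]
    have "normal_form (word w * y) = normal_form (word zs * ?q)"
      by (simp add: right_diff_distrib normal_form_diff w_eq word_append mult.assoc)
    moreover have "keep (normal_form (word zs * ?q)) = 0"
      by (rule zero) (rule normal_form_cong(2)[OF HB H L hy])
    moreover have "keep (word w) = 0"
      using zs False by (cases zs) (auto simp: keep_word w_eq)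
    ultimately show ?thesis using J(2) by simp
  qed
qed

lemma keep_normal_form_mult:
  assumes y: "y \<in> A L"
  shows "keep (normal_form (a * y)) - keep (normal_form a) * y \<in> J L"
proof -
  note J = enveloping_ideal_closed[OF L]
  have "normal_form a \<in> normal_words B"
    by (rule normal_form_cong[OF order_refl span_B lie_subalgebra_UNIV]) simp
  then have "keep (normal_form (normal_form a * y)) - keep (normal_form a) * y \<in> J L"
  proof (induction rule: FA.span_induct_alt)
    case base
    then show ?case using J(2) by (simp add: normal_form_0 keep_0)
  next
    case (step c x p)
    have "keep (normal_form (x * y)) - keep x * y \<in> J L"
      using step keep_normal_form_word[OF _ _ y] by blast
    with step have "const c * (keep (normal_form (x * y)) - keep x * y)
        + (keep (normal_form (p * y)) - keep p * y) \<in> J L"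
      using J(3,6) by blast
    then show ?case
      by (simp add: distrib_right mult.assoc normal_form_add normal_form_scale keep_add keep_scale
          algebra_simps)
  qed
  then show ?thesis by (simp add: normal_form_idem_left)
qed

end

end

context lie_algebra
begin

text \<open>\<open>U(L)\<close> is a direct summand of \<open>U(\<gg>)\<close> as a right \<open>U(L)\<close>-module. The projection is stated for
  representatives in the free algebra, hence as congruences modulo \<open>J L\<close>.\<close>

proposition ex_projection:
  assumes L: "liesub L"
  obtains \<pi> where "\<And>p q. \<pi> (p + q) = \<pi> p + \<pi> q" "\<And>p. \<pi> p \<in> A L" "\<And>p. p \<in> J UNIV \<Longrightarrow> \<pi> p = 0"
    "\<And>p. p \<in> A L \<Longrightarrow> \<pi> p - p \<in> J L" "\<And>a p. p \<in> A L \<Longrightarrow> \<pi> (a * p) - \<pi> a * p \<in> J L"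
proof -
  have subL: "subspace L" using L by (simp add: lie_subalgebra_def)
  obtain H where H: "H \<subseteq> L" "independent H" "L \<subseteq> span H"
    using maximal_independent_subset by blast
  then have span: "span H = L" using span_minimal[OF _ subL] by blast
  obtain r :: "'g rel" where "well_order_on UNIV r" using well_order_on by blast
  then have r: "trans r" "antisym r" "total r"
    by (auto simp: well_order_on_def linear_order_on_def partial_order_on_def preorder_on_def)
  \<comment> \<open>The well-ordering theorem supplies a linear order on all elements; \<open>H\<close> is moved to its end.\<close>
  define lt where "lt a b \<longleftrightarrow> a \<notin> H \<and> b \<in> H \<or> (a \<in> H \<longleftrightarrow> b \<in> H) \<and> a \<noteq> b \<and> (a, b) \<in> r" for a b
  interpret ordered_basis_lie_algebra scale bracket "extend_basis H" lt
  proof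
    show "lt x z" if "lt x y" "lt y z" for x y z
      using that transD[OF r(1), of x y z] antisymD[OF r(2), of x y] unfolding lt_def by blast
    show "lt x y \<or> lt y x" if "x \<noteq> y" for x y
      using that r(3) unfolding lt_def total_on_def by blast
  qed (auto simp: independent_extend_basis[OF H(2)] span_extend_basis[OF H(2)] lt_def)
  have sub: "H \<subseteq> extend_basis H" by (rule extend_basis_superset[OF H(2)])
  have lt_H: "lt a b" if "a \<notin> H" "b \<in> H" for a b using that by (simp add: lt_def)
  let ?keep = "keep H"
  show ?thesis
  proof (rule that[of "\<lambda>p. ?keep (normal_form p)"])
    show "?keep (normal_form (p + q)) = ?keep (normal_form p) + ?keep (normal_form q)" for p q
      by (simp add: normal_form_add keep_add[OF sub span L lt_H])
    show "?keep (normal_form p) \<in> A L" for p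
      by (rule keep_in[OF sub span L lt_H])
    show "?keep (normal_form p) = 0" if "p \<in> J UNIV" for p
      by (simp add: normal_form_enveloping_ideal[OF that] keep_0[OF sub span L lt_H])
    show "?keep (normal_form p) - p \<in> J L" if "p \<in> A L" for p
      by (rule keep_normal_form[OF sub span L lt_H that])
    show "?keep (normal_form (a * p)) - ?keep (normal_form a) * p \<in> J L" if "p \<in> A L" for a p
      by (rule keep_normal_form_mult[OF sub span L lt_H that])
  qed
qed

text \<open>The left ideal \<open>ext I\<close> of \<open>U(L')\<close> meets \<open>U(L)\<close> in \<open>I\<close> because the projection is right
  \<open>U(L)\<close>-linear and fixes \<open>U(L)\<close>. So \<open>ext\<close> embeds the chains of left ideals of \<open>U(L)\<close> in those
  of \<open>U(L')\<close>.\<close>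

theorem noetherian_enveloping_subalgebra:
  assumes L: "liesub L" and L': "liesub L'" and sub: "L \<subseteq> L'"
    and noeth: "noetherian (enveloping_algebra scale bracket L')"
  shows "noetherian (enveloping_algebra scale bracket L)"
proof -
  obtain \<pi> where \<pi>: "\<And>p q. \<pi> (p + q) = \<pi> p + \<pi> q" "\<And>p. \<pi> p \<in> A L" "\<And>p. p \<in> J UNIV \<Longrightarrow> \<pi> p = 0"
    "\<And>p. p \<in> A L \<Longrightarrow> \<pi> p - p \<in> J L" "\<And>a p. p \<in> A L \<Longrightarrow> \<pi> (a * p) - \<pi> a * p \<in> J L"
    using ex_projection[OF L] by blast
  note J = enveloping_ideal_closed[OF L] and J' = enveloping_ideal_closed[OF L']
  define ext where "ext I = {p \<in> A L'. \<forall>a\<in>A L'. \<pi> (a * p) \<in> I}" for I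
  have ext_ideal: "env_left_ideal L' (ext I)" if I: "env_left_ideal L I" for I
    unfolding env_left_ideal_def
  proof (intro conjI ballI)
    have "\<pi> (a * p) = 0" if "p \<in> J L'" "a \<in> A L'" for a p
      using J'(4)[OF that] enveloping_ideal_mono[OF L' lie_subalgebra_UNIV] \<pi>(3) by blast
    then show "J L' \<subseteq> ext I"
      using J'(1) J(2) I unfolding ext_def env_left_ideal_def by auto
    fix p q assume "p \<in> ext I" "q \<in> ext I"
    then show "p + q \<in> ext I"
      using I by (simp add: ext_def env_left_ideal_def distrib_left \<pi>(1) free_algebra_closed)
  next
    fix a p assume "a \<in> A L'" "p \<in> ext I"
    then show "a * p \<in> ext I"
      by (simp add: ext_def free_algebra_closed flip: mult.assoc)
  qed (auto simp: ext_def)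
  \<comment> \<open>\<open>\<supseteq>\<close> is right linearity of \<open>\<pi>\<close>; for \<open>\<subseteq>\<close> take \<open>a = 1\<close>, since \<open>\<pi>\<close> fixes \<open>U(L)\<close>.\<close>
  have contract: "ext I \<inter> A L = I" if I: "env_left_ideal L I" for I
  proof (intro equalityI subsetI)
    fix p assume p: "p \<in> ext I \<inter> A L"
    have "1 \<in> A L'" using word_in_free_algebra[of "[]"] by (simp add: word_Nil)
    then have "\<pi> p \<in> I" using p by (auto simp: ext_def dest: bspec[of _ _ 1])
    moreover have "p - \<pi> p \<in> I"
      using J(7)[OF \<pi>(4)[of p]] p I unfolding env_left_ideal_def by auto
    ultimately have "\<pi> p + (p - \<pi> p) \<in> I" using I unfolding env_left_ideal_def by blast
    then show "p \<in> I" by simp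
  next
    fix p assume p: "p \<in> I"
    then have pL: "p \<in> A L" using I unfolding env_left_ideal_def by blast
    have "\<pi> (a * p) \<in> I" for a
    proof -
      have "\<pi> a * p \<in> I" "\<pi> (a * p) - \<pi> a * p \<in> I"
        using I p \<pi>(2) \<pi>(5)[OF pL] unfolding env_left_ideal_def by blast+
      then have "\<pi> a * p + (\<pi> (a * p) - \<pi> a * p) \<in> I" using I unfolding env_left_ideal_def by blast
      then show ?thesis by simp
    qed
    then show "p \<in> ext I \<inter> A L"
      using pL free_algebra_mono[OF sub] by (auto simp: ext_def)
  qed
  show ?thesis
    unfolding noetherian_enveloping_algebra_iff[OF L]
  proof (intro allI impI, elim conjE)
    fix I :: "nat \<Rightarrow> ('g free_monoid \<Rightarrow>\<^sub>0 'k) set"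
    assume I: "\<forall>n. env_left_ideal L (I n)" "\<forall>n. I n \<subseteq> I (Suc n)"
    have "\<forall>n. env_left_ideal L' (ext (I n))" using I(1) ext_ideal by blast
    moreover have "\<forall>n. ext (I n) \<subseteq> ext (I (Suc n))" using I(2) by (auto simp: ext_def)
    ultimately obtain N where "\<forall>n\<ge>N. ext (I n) = ext (I N)"
      using noeth[unfolded noetherian_enveloping_algebra_iff[OF L'], rule_format, of "\<lambda>n. ext (I n)"]
      by auto
    then show "\<exists>N. \<forall>n\<ge>N. I n = I N"
      using contract I(1) by metis
  qed
qed

end

section \<open>Chains indexed by multisets\<close>

lemma nondecreasing_nat_subsequence:
  fixes s :: "nat \<Rightarrow> nat"
  obtains f :: "nat \<Rightarrow> nat" where "strict_mono f" "mono (s \<circ> f)"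
proof -
  obtain f :: "nat \<Rightarrow> nat" where f: "strict_mono f" "monoseq (\<lambda>n. s (f n))"
    using seq_monosub by blast
  from f(2) consider "mono (s \<circ> f)" | "antimono (s \<circ> f)"
    by (auto simp: monoseq_iff o_def)
  then show thesis
  proof cases
    case 1
    then show ?thesis using that f(1) by blast
  next
    case 2
    define k where "k = (ARG_MIN (\<lambda>j. s (f j)) j. True)"
    have least: "s (f k) \<le> s (f j)" for j
      unfolding k_def by (rule arg_min_nat_le) simp
    have const: "s (f (j + k)) = s (f k)" for j
      using antimonoD[OF 2, of k "j + k"] least[of "j + k"] by simp
    have "strict_mono (\<lambda>j. f (j + k))"
      using f(1) by (simp add: strict_mono_def)
    moreover have "mono (s \<circ> (\<lambda>j. f (j + k)))"
      by (simp add: mono_def const)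
    ultimately show ?thesis by (rule that)
  qed
qed

text \<open>Dickson's lemma, for infinite sequences.\<close>

lemma dickson_multiset:
  fixes a :: "nat \<Rightarrow> nat multiset"
  assumes "\<And>k. set_mset (a k) \<subseteq> {..<N}"
  obtains f :: "nat \<Rightarrow> nat" where "strict_mono f" "\<And>j. a (f j) \<subseteq># a (f (Suc j))"
proof -
  have "\<exists>f :: nat \<Rightarrow> nat. strict_mono f \<and> (\<forall>i<n. mono (\<lambda>j. count (a (f j)) i))" for n
  proof (induction n)
    case 0
    show ?case by (rule exI[of _ id]) (simp add: strict_mono_def)
  next
    case (Suc n)
    then obtain f :: "nat \<Rightarrow> nat" where f: "strict_mono f" "\<And>i. i < n \<Longrightarrow> mono (\<lambda>j. count (a (f j)) i)"
      by blast
    obtain g :: "nat \<Rightarrow> nat" where g: "strict_mono g" "mono ((\<lambda>j. count (a (f j)) n) \<circ> g)"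
      by (rule nondecreasing_nat_subsequence)
    have "mono (\<lambda>j. count (a (f (g j))) i)" if "i < Suc n" for i
    proof (cases "i = n")
      case True
      then show ?thesis using g(2) by (simp add: o_def)
    next
      case False
      then show ?thesis
        using that f(2)[of i] monoD[OF strict_mono_mono[OF g(1)]] by (simp add: mono_def)
    qed
    moreover have "strict_mono (f \<circ> g)" using f(1) g(1) by (rule strict_mono_o)
    ultimately show ?case by (intro exI[of _ "f \<circ> g"]) (simp add: o_def)
  qed
  then obtain f :: "nat \<Rightarrow> nat" where f: "strict_mono f" "\<And>i. i < N \<Longrightarrow> mono (\<lambda>j. count (a (f j)) i)"
    by blast
  have "count (a (f j)) i \<le> count (a (f (Suc j))) i" for i j
  proof (cases "i < N")
    case True
    then show ?thesis using monoD[OF f(2)[OF True], of j "Suc j"] by simp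
  next
    case False
    then have "i \<notin># a (f j)" using assms[of "f j"] by auto
    then show ?thesis by (simp add: not_in_iff)
  qed
  then show thesis using that[OF f(1)] by (simp add: subseteq_mset_def)
qed

text \<open>If the family never became stationary, there would be changes at exponents \<open>\<alpha> M\<close> for infinitely
  many indices \<open>M\<close>. By Dickson's lemma these exponents may be taken increasing, and then the members of
  the family at which changes occur form an ascending chain that is not stationary.\<close>

lemma stabilize_multiset_family:
  fixes F :: "nat \<Rightarrow> nat multiset \<Rightarrow> 'a set"
  assumes mono_n: "\<And>n \<alpha>. F n \<alpha> \<subseteq> F (Suc n) \<alpha>"
    and mono_\<alpha>: "\<And>n \<alpha> \<beta>. set_mset \<beta> \<subseteq> {..<N} \<Longrightarrow> \<alpha> \<subseteq># \<beta> \<Longrightarrow> F n \<alpha> \<subseteq> F n \<beta>"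
    and acc: "\<And>n \<alpha>. P (F n \<alpha>)"
      "\<And>K :: nat \<Rightarrow> 'a set. (\<And>j. P (K j)) \<Longrightarrow> (\<And>j. K j \<subseteq> K (Suc j)) \<Longrightarrow> \<exists>J. \<forall>j\<ge>J. K j = K J"
  shows "\<exists>M. \<forall>n\<ge>M. \<forall>\<alpha>. set_mset \<alpha> \<subseteq> {..<N} \<longrightarrow> F n \<alpha> = F M \<alpha>"
proof (rule ccontr)
  assume "\<not> ?thesis"
  then have "\<forall>M. \<exists>n \<alpha>. n \<ge> M \<and> set_mset \<alpha> \<subseteq> {..<N} \<and> F n \<alpha> \<noteq> F M \<alpha>" by auto
  then obtain n \<alpha> where n: "\<And>M. n M \<ge> M" and \<alpha>: "\<And>M. set_mset (\<alpha> M) \<subseteq> {..<N}"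
    and neq: "\<And>M. F (n M) (\<alpha> M) \<noteq> F M (\<alpha> M)"
    by metis
  \<comment> \<open>Each \<open>n M\<close> is an index by which the member at \<open>\<alpha> M\<close> has changed; iterating \<open>n\<close> from 0 visits such changes one after the other.\<close>
  define M where "M k = (n ^^ k) 0" for k
  have M_Suc: "M (Suc k) = n (M k)" for k by (simp add: M_def)
  have M_mono: "mono M" by (rule monoI, rule lift_Suc_mono_le) (simp_all add: M_Suc n)
  have F_mono: "F i \<beta> \<subseteq> F j \<beta>" if "i \<le> j" for i j \<beta>
    by (rule lift_Suc_mono_le[of "\<lambda>i. F i \<beta>"]) (use mono_n that in auto)
  obtain f :: "nat \<Rightarrow> nat" where f: "strict_mono f" "\<And>j. \<alpha> (M (f j)) \<subseteq># \<alpha> (M (f (Suc j)))"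
    using dickson_multiset[of "\<lambda>k. \<alpha> (M k)" N] \<alpha> by blast
  define K where "K j = F (M (f j)) (\<alpha> (M (f j)))" for j
  have step: "F (M (Suc (f j))) (\<alpha> (M (f j))) \<subseteq> K (Suc j)" for j
  proof -
    have "Suc (f j) \<le> f (Suc j)" using strict_monoD[OF f(1), of j "Suc j"] by simp
    then have "F (M (Suc (f j))) (\<alpha> (M (f j))) \<subseteq> F (M (f (Suc j))) (\<alpha> (M (f j)))"
      using F_mono monoD[OF M_mono] by blast
    also have "\<dots> \<subseteq> K (Suc j)" unfolding K_def by (rule mono_\<alpha>[OF \<alpha> f(2)])
    finally show ?thesis .
  qed
  have incr: "K j \<subseteq> F (M (Suc (f j))) (\<alpha> (M (f j)))" for j
    unfolding K_def by (rule F_mono) (simp add: M_Suc n)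
  have "\<exists>J. \<forall>j\<ge>J. K j = K J"
  proof (rule acc(2))
    show "P (K j)" for j unfolding K_def by (rule acc(1))
    show "K j \<subseteq> K (Suc j)" for j using incr step by blast
  qed
  then obtain J where J: "\<And>j. j \<ge> J \<Longrightarrow> K j = K J" by blast
  have "K (Suc J) = K J" by (rule J) simp
  then have "F (M (Suc (f J))) (\<alpha> (M (f J))) = F (M (f J)) (\<alpha> (M (f J)))"
    using incr[of J] step[of J] by (auto simp: K_def)
  then show False using neq[of "M (f J)"] by (simp add: M_Suc)
qed

section \<open>A basis theorem for weighted generators\<close>

text \<open>The elements of weight 0 form the coefficient algebra \<open>L\<close>. The assumption \<open>wt_bracket\<close> makes
  commutators smaller than products, except within \<open>L\<close>, which need not be abelian. The assumption
  \<open>spanning\<close> says that \<open>x\<close> is a combination of elements of \<open>L\<close> and of those generators whose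
  weight does not exceed that of \<open>x\<close>; in this form no coefficients have to be named.\<close>

locale weighted_generators = lie_algebra scale bracket
  for scale :: "'k::field \<Rightarrow> 'g::ab_group_add \<Rightarrow> 'g" and bracket :: "'g \<Rightarrow> 'g \<Rightarrow> 'g" +
  fixes L :: "'g set" and wt :: "'g \<Rightarrow> nat" and z :: "nat \<Rightarrow> 'g" and N :: nat
  assumes L: "liesub L"
    and wt_eq_0: "wt x = 0 \<longleftrightarrow> x \<in> L"
    and wt_bracket: "wt x + wt y > 0 \<Longrightarrow> wt (bracket x y) < wt x + wt y"
    and wt_z: "i < N \<Longrightarrow> wt (z i) > 0"
    and spanning: "subspace V \<Longrightarrow> L \<subseteq> V \<Longrightarrow> (\<And>i. i < N \<Longrightarrow> wt (z i) \<le> wt x \<Longrightarrow> z i \<in> V) \<Longrightarrow> x \<in> V"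
begin

abbreviation JU :: "('g free_monoid \<Rightarrow>\<^sub>0 'k) set" where
  "JU \<equiv> J UNIV"

lemmas JU = enveloping_ideal_closed[OF lie_subalgebra_UNIV, simplified]

lemma JU_mult: "p \<in> JU \<Longrightarrow> a * p \<in> JU" "p \<in> JU \<Longrightarrow> p * a \<in> JU"
  using JU(4,5) free_algebra_UNIV by blast+

definition word_weight :: "'g list \<Rightarrow> nat" where
  "word_weight w = sum_list (map wt w)"

lemma word_weight_simps [simp]:
  "word_weight [] = 0" "word_weight (x # w) = wt x + word_weight w" "word_weight (u @ v) = word_weight u + word_weight v"
  by (simp_all add: word_weight_def)

lemma word_weight_L: "set u \<subseteq> L \<Longrightarrow> word_weight u = 0"
  using wt_eq_0 by (auto simp: word_weight_def)

text \<open>The filtration by weight, with a strict bound: the lower-order terms in weight \<open>n\<close> are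
  the elements of \<open>light_span n\<close>, and for \<open>n = 0\<close> only the relations remain.\<close>

definition light_span :: "nat \<Rightarrow> ('g free_monoid \<Rightarrow>\<^sub>0 'k) set" where
  "light_span n = FA.span (JU \<union> word ` {w. word_weight w < n})"

lemma subspace_light_span: "FA.subspace (light_span n)"
  by (simp add: light_span_def)

lemma JU_light_span: "p \<in> JU \<Longrightarrow> p \<in> light_span n"
  by (simp add: light_span_def FA.span_base)

lemma word_light_span: "word_weight w < n \<Longrightarrow> word w \<in> light_span n"
  by (simp add: light_span_def FA.span_base)

lemma span_mult:
  assumes p: "p \<in> FA.span S" and T: "FA.subspace T"
  shows "(\<And>x. x \<in> S \<Longrightarrow> a * x \<in> T) \<Longrightarrow> a * p \<in> T"
    and "(\<And>x. x \<in> S \<Longrightarrow> x * a \<in> T) \<Longrightarrow> p * a \<in> T"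
proof -
  show "a * p \<in> T" if "\<And>x. x \<in> S \<Longrightarrow> a * x \<in> T"
    using p
  proof (induction rule: FA.span_induct_alt)
    case (step c x y)
    then show ?case
      using that FA.subspace_add[OF T FA.subspace_scale[OF T]]
      by (simp add: distrib_left const_left_commute)
  qed (simp add: FA.subspace_0[OF T])
  show "p * a \<in> T" if "\<And>x. x \<in> S \<Longrightarrow> x * a \<in> T"
    using p
  proof (induction rule: FA.span_induct_alt)
    case (step c x y)
    then show ?case
      using that FA.subspace_add[OF T FA.subspace_scale[OF T]]
      by (simp add: distrib_right mult.assoc)
  qed (simp add: FA.subspace_0[OF T])
qed

lemma light_span_word_mult:
  assumes "p \<in> light_span n" "word_weight u + n \<le> m"
  shows "word u * p \<in> light_span m" "p * word u \<in> light_span m"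
proof -
  note p = assms(1)[unfolded light_span_def]
  show "word u * p \<in> light_span m"
  proof (rule span_mult(1)[OF p subspace_light_span])
    show "word u * x \<in> light_span m" if "x \<in> JU \<union> word ` {w. word_weight w < n}" for x
      using that assms(2) by (auto simp: JU_light_span JU_mult word_append[symmetric] intro!: word_light_span)
  qed
  show "p * word u \<in> light_span m"
  proof (rule span_mult(2)[OF p subspace_light_span])
    show "x * word u \<in> light_span m" if "x \<in> JU \<union> word ` {w. word_weight w < n}" for x
      using that assms(2) by (auto simp: JU_light_span JU_mult word_append[symmetric] intro!: word_light_span)
  qed
qed

lemma light_span_A_mult:
  assumes r: "r \<in> A L" and p: "p \<in> light_span n"
  shows "r * p \<in> light_span n"
  using r
proof (induction rule: free_algebra_induct)
  case (word w)
  then show ?case using light_span_word_mult(1)[OF p] word_weight_L[of w] by simp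
qed (use FA.subspace_0[OF subspace_light_span] FA.subspace_add[OF subspace_light_span] FA.subspace_scale[OF subspace_light_span]
    in \<open>auto simp: distrib_right mult.assoc\<close>)

lemma commutator_light_span:
  assumes "wt x + wt y > 0"
  shows "gen x * gen y - gen y * gen x \<in> light_span (wt x + wt y)"
proof -
  have "gen (bracket x y) \<in> light_span (wt x + wt y)"
    unfolding gen_eq_word by (rule word_light_span) (use wt_bracket[OF assms] in simp)
  with enveloping_ideal_relations(3)[OF lie_subalgebra_UNIV UNIV_I UNIV_I, THEN JU_light_span]
  have "(gen x * gen y - gen y * gen x - gen (bracket x y)) + gen (bracket x y) \<in> light_span (wt x + wt y)"
    by (rule FA.subspace_add[OF subspace_light_span])
  then show ?thesis by simp
qed

text \<open>Coefficients commute with generators up to terms of smaller weight, as polynomial coefficients do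
  with the variables.\<close>

lemma commutator_A_light_span:
  assumes "wt x > 0" and r: "r \<in> A L"
  shows "gen x * r - r * gen x \<in> light_span (wt x)"
  using r
proof (induction rule: free_algebra_induct)
  case zero
  then show ?case using FA.subspace_0[OF subspace_light_span] by simp
next
  case (add p q)
  then show ?case
    using FA.subspace_add[OF subspace_light_span add] by (simp add: distrib_left distrib_right algebra_simps)
next
  case (scale c p)
  have "gen x * (const c * p) - const c * p * gen x = const c * (gen x * p - p * gen x)"
    by (simp add: const_left_commute right_diff_distrib mult.assoc)
  then show ?case
    using FA.subspace_scale[OF subspace_light_span scale] by simp
next
  case (word w)
  then show ?case
  proof (induction w)
    case Nil
    then show ?case using FA.subspace_0[OF subspace_light_span] by (simp add: word_Nil)
  next
    case (Cons a w)
    have a: "wt a = 0" using Cons.prems wt_eq_0 by simp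
    have "(gen x * gen a - gen a * gen x) * word w \<in> light_span (wt x)"
      using light_span_word_mult(2)[OF commutator_light_span[of x a]] a assms(1) word_weight_L[of w] Cons.prems by simp
    moreover have "gen a * (gen x * word w - word w * gen x) \<in> light_span (wt x)"
      using light_span_word_mult(1)[of _ "wt x" "[a]"] Cons a by (simp add: gen_eq_word)
    ultimately have "(gen x * gen a - gen a * gen x) * word w
        + gen a * (gen x * word w - word w * gen x) \<in> light_span (wt x)"
      by (rule FA.subspace_add[OF subspace_light_span])
    then show ?case by (simp add: word_Cons algebra_simps)
  qed
qed

definition monomial :: "nat multiset \<Rightarrow> ('g free_monoid \<Rightarrow>\<^sub>0 'k)" where
  "monomial \<alpha> = word (map z (sorted_list_of_multiset \<alpha>))"

definition exp_weight :: "nat multiset \<Rightarrow> nat" where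
  "exp_weight \<alpha> = (\<Sum>i\<in>#\<alpha>. wt (z i))"

lemma word_weight_monomial: "word_weight (map z (sorted_list_of_multiset \<alpha>)) = exp_weight \<alpha>"
proof -
  have "sum_list (map (wt \<circ> z) (sorted_list_of_multiset \<alpha>)) =
      sum_mset (image_mset (wt \<circ> z) (mset (sorted_list_of_multiset \<alpha>)))"
    by (metis mset_map sum_mset_sum_list)
  then show ?thesis by (simp add: word_weight_def exp_weight_def o_def)
qed

lemma exp_weight_add_mset [simp]: "exp_weight (add_mset i \<alpha>) = wt (z i) + exp_weight \<alpha>"
  by (simp add: exp_weight_def)

text \<open>Moving a generator to its place in a sorted monomial costs terms of smaller weight.\<close>

lemma gen_insort:
  assumes "wt x > 0" "x = z i"
  shows "gen x * word (map z l) - word (map z (insort i l)) \<in> light_span (wt x + word_weight (map z l))"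
proof (induction l)
  case Nil
  then show ?case using assms FA.subspace_0[OF subspace_light_span] by (simp add: word_Nil word_Cons)
next
  case (Cons j l)
  show ?case
  proof (cases "i \<le> j")
    case True
    then show ?thesis using assms FA.subspace_0[OF subspace_light_span] by (simp add: word_Cons)
  next
    case False
    have "(gen x * gen (z j) - gen (z j) * gen x) * word (map z l) \<in> light_span (wt x + word_weight (map z (j # l)))"
      by (rule light_span_word_mult(2)[OF commutator_light_span]) (use assms in auto)
    moreover have "gen (z j) * (gen x * word (map z l) - word (map z (insort i l)))
        \<in> light_span (wt x + word_weight (map z (j # l)))"
      using light_span_word_mult(1)[OF Cons, of "[z j]"] by (simp add: gen_eq_word)
    ultimately have "(gen x * gen (z j) - gen (z j) * gen x) * word (map z l) +
        gen (z j) * (gen x * word (map z l) - word (map z (insort i l)))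
        \<in> light_span (wt x + word_weight (map z (j # l)))"
      by (rule FA.subspace_add[OF subspace_light_span])
    then show ?thesis using False by (simp add: word_Cons algebra_simps)
  qed
qed

text \<open>In the associated graded ring, multiplication by a generator shifts exponents.\<close>

lemma gen_mult_term:
  assumes i: "i < N" and r: "r \<in> A L"
  shows "gen (z i) * (r * monomial \<alpha>) - r * monomial (add_mset i \<alpha>) \<in> light_span (wt (z i) + exp_weight \<alpha>)"
proof -
  have "(gen (z i) * r - r * gen (z i)) * monomial \<alpha> \<in> light_span (wt (z i) + exp_weight \<alpha>)"
    unfolding monomial_def
    by (rule light_span_word_mult(2)[OF commutator_A_light_span[OF wt_z[OF i] r]]) (simp add: word_weight_monomial)
  moreover have "r * (gen (z i) * monomial \<alpha> - monomial (add_mset i \<alpha>)) \<in> light_span (wt (z i) + exp_weight \<alpha>)"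
    using light_span_A_mult[OF r gen_insort[OF wt_z[OF i] refl, of "sorted_list_of_multiset \<alpha>"]]
    by (simp add: monomial_def word_weight_monomial)
  ultimately have "(gen (z i) * r - r * gen (z i)) * monomial \<alpha> +
      r * (gen (z i) * monomial \<alpha> - monomial (add_mset i \<alpha>)) \<in> light_span (wt (z i) + exp_weight \<alpha>)"
    by (rule FA.subspace_add[OF subspace_light_span])
  then show ?thesis by (simp add: algebra_simps)
qed

definition exps :: "nat multiset set" where
  "exps = {\<alpha>. set_mset \<alpha> \<subseteq> {..<N}}"

lemma add_mset_exps: "add_mset i \<alpha> \<in> exps \<longleftrightarrow> i < N \<and> \<alpha> \<in> exps"
  by (simp add: exps_def)

text \<open>Coefficients stand on the left, so this is a left \<open>U(L)\<close>-module. The relations belong to it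
  because elements of \<open>U(\<gg>)\<close> are handled through representatives.\<close>

definition monomial_span :: "nat multiset set \<Rightarrow> ('g free_monoid \<Rightarrow>\<^sub>0 'k) set" where
  "monomial_span D = FA.span (JU \<union> {word u * monomial \<beta> | u \<beta>. set u \<subseteq> L \<and> \<beta> \<in> D})"

lemma subspace_monomial_span: "FA.subspace (monomial_span D)"
  by (simp add: monomial_span_def)

lemma JU_monomial_span: "p \<in> JU \<Longrightarrow> p \<in> monomial_span D"
  by (simp add: monomial_span_def FA.span_base)

lemma term_monomial_span: "r \<in> A L \<Longrightarrow> \<beta> \<in> D \<Longrightarrow> r * monomial \<beta> \<in> monomial_span D"
proof (induction rule: free_algebra_induct)
  case (word w)
  then show ?case unfolding monomial_span_def by (intro FA.span_base) blast
qed (use FA.subspace_0[OF subspace_monomial_span] FA.subspace_add[OF subspace_monomial_span]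
      FA.subspace_scale[OF subspace_monomial_span] in \<open>auto simp: distrib_right mult.assoc\<close>)

lemma monomial_span_mono: "D \<subseteq> D' \<Longrightarrow> monomial_span D \<subseteq> monomial_span D'"
  unfolding monomial_span_def by (rule FA.span_mono) blast

lemma monomial_span_mult:
  assumes p: "p \<in> monomial_span D" and T: "FA.subspace T" and J: "JU \<subseteq> T"
    and terms: "\<And>r \<beta>. r \<in> A L \<Longrightarrow> \<beta> \<in> D \<Longrightarrow> a * (r * monomial \<beta>) \<in> T"
  shows "a * p \<in> T"
  using p unfolding monomial_span_def
proof (rule span_mult(1)[OF _ T])
  fix x assume "x \<in> JU \<union> {word u * monomial \<beta> |u \<beta>. set u \<subseteq> L \<and> \<beta> \<in> D}"
  then show "a * x \<in> T"
    using J JU_mult(1) terms word_in_free_algebra by blast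
qed

lemma monomial_span_A_mult:
  assumes r: "r \<in> A L" and p: "p \<in> monomial_span D"
  shows "r * p \<in> monomial_span D"
  by (rule monomial_span_mult[OF p subspace_monomial_span])
    (auto simp: JU_monomial_span intro!: term_monomial_span free_algebra_closed(3) r simp flip: mult.assoc)

text \<open>Sorted monomials with coefficients span the filtration. The first letter of a word either
  belongs to the coefficients, or has positive weight; in that case the rest of the word is
  lighter, so it is already a combination of monomials, and \<open>spanning\<close> reduces the letter
  to elements of \<open>L\<close> and generators.\<close>

lemma light_span_monomial_span: "light_span n \<subseteq> monomial_span {\<beta> \<in> exps. exp_weight \<beta> < n}"
proof -
  have words: "word w \<in> monomial_span {\<beta> \<in> exps. exp_weight \<beta> < Suc n}" if "word_weight w = n" for w n
    using that
  proof (induction n arbitrary: w rule: less_induct)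
    case (less n)
    have light_span: "light_span m \<subseteq> monomial_span {\<beta> \<in> exps. exp_weight \<beta> < Suc n}" if "m \<le> n" for m
    proof -
      have "word v \<in> monomial_span {\<beta> \<in> exps. exp_weight \<beta> < Suc n}" if "word_weight v < m" for v
        using less.IH[of "word_weight v" v] that \<open>m \<le> n\<close>
          monomial_span_mono[of "{\<beta> \<in> exps. exp_weight \<beta> < Suc (word_weight v)}" "{\<beta> \<in> exps. exp_weight \<beta> < Suc n}"] by fastforce
      then show ?thesis
        unfolding light_span_def by (intro FA.span_minimal subspace_monomial_span) (auto simp: JU_monomial_span)
    qed
    show ?case
      using less.prems
    proof (induction w)
      case Nil
      have "1 * monomial {#} \<in> monomial_span {\<beta> \<in> exps. exp_weight \<beta> < Suc n}"
        using word_in_free_algebra[of "[]" L]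
        by (intro term_monomial_span) (auto simp: word_Nil exps_def exp_weight_def)
      then show ?case by (simp add: monomial_def)
    next
      case (Cons x v)
      show ?case
      proof (cases "wt x = 0")
        case True
        then have "x \<in> L" by (simp add: wt_eq_0)
        then show ?thesis
          using monomial_span_A_mult[OF gen_in_free_algebra Cons.IH] True Cons.prems by (simp add: word_Cons)
      next
        case False
        have v: "word v \<in> monomial_span {\<beta> \<in> exps. exp_weight \<beta> < Suc (word_weight v)}"
          using less.IH False Cons.prems by auto
        show ?thesis
          unfolding word_Cons
        proof (rule monomial_span_mult[OF v subspace_monomial_span])
          show "JU \<subseteq> monomial_span {\<beta> \<in> exps. exp_weight \<beta> < Suc n}" by (auto simp: JU_monomial_span)
          fix r \<beta> assume r: "r \<in> A L" and "\<beta> \<in> {\<beta> \<in> exps. exp_weight \<beta> < Suc (word_weight v)}"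
          then have \<beta>: "\<beta> \<in> exps" "exp_weight \<beta> \<le> word_weight v" by auto
          \<comment> \<open>A subspace of the Lie algebra that contains \<open>L\<close> and all generators of weight at most \<open>wt x\<close>.\<close>
          define V where "V = {y. gen y * (r * monomial \<beta>) \<in> monomial_span {\<beta> \<in> exps. exp_weight \<beta> < Suc n}}"
          have "x \<in> V"
          proof (rule spanning)
            note rel = enveloping_ideal_relations[OF lie_subalgebra_UNIV UNIV_I]
            have cong: "p * q \<in> monomial_span D" if "p - p' \<in> JU" "p' * q \<in> monomial_span D" for p p' q D
              using FA.subspace_add[OF subspace_monomial_span JU_monomial_span[OF JU_mult(2)[OF that(1), of q]] that(2)]
              by (simp add: left_diff_distrib)
            show "subspace V"
              unfolding subspace_def
            proof (intro conjI ballI allI)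
              have "gen 0 - const 0 * gen 0 \<in> JU" using rel(2)[of 0 0] by simp
              then have "gen 0 * (r * monomial \<beta>) \<in> monomial_span D" for D
                by (rule cong) (simp add: FA.subspace_0[OF subspace_monomial_span])
              then show "0 \<in> V" by (simp add: V_def)
              fix y y' assume yy': "y \<in> V" "y' \<in> V"
              have "gen (y + y') - (gen y + gen y') \<in> JU"
                using rel(1)[of y' y] by (simp add: diff_diff_eq)
              moreover have "(gen y + gen y') * (r * monomial \<beta>) \<in> monomial_span {\<beta> \<in> exps. exp_weight \<beta> < Suc n}"
                unfolding distrib_right
                by (rule FA.subspace_add[OF subspace_monomial_span]) (use yy' in \<open>simp_all add: V_def\<close>)
              ultimately have "gen (y + y') * (r * monomial \<beta>) \<in> monomial_span {\<beta> \<in> exps. exp_weight \<beta> < Suc n}"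
                by (rule cong)
              then show "y + y' \<in> V" by (simp add: V_def)
            next
              fix c y assume y: "y \<in> V"
              have "(const c * gen y) * (r * monomial \<beta>) \<in> monomial_span {\<beta> \<in> exps. exp_weight \<beta> < Suc n}"
                unfolding mult.assoc[of "const c"]
                by (rule FA.subspace_scale[OF subspace_monomial_span]) (use y in \<open>simp add: V_def\<close>)
              then have "gen (scale c y) * (r * monomial \<beta>) \<in> monomial_span {\<beta> \<in> exps. exp_weight \<beta> < Suc n}"
                by (rule cong[OF rel(2)])
              then show "scale c y \<in> V" by (simp add: V_def)
            qed
            show "L \<subseteq> V"
              using \<beta> Cons.prems term_monomial_span[OF free_algebra_closed(3)[OF gen_in_free_algebra r]]
              by (auto simp: V_def simp flip: mult.assoc)
            fix i assume i: "i < N" "wt (z i) \<le> wt x"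
            have "wt (z i) + exp_weight \<beta> \<le> n" using i(2) \<beta>(2) Cons.prems by simp
            then have "gen (z i) * (r * monomial \<beta>) - r * monomial (add_mset i \<beta>)
                \<in> monomial_span {\<beta> \<in> exps. exp_weight \<beta> < Suc n}"
              using gen_mult_term[OF i(1) r, of \<beta>] light_span by blast
            moreover have "r * monomial (add_mset i \<beta>) \<in> monomial_span {\<beta> \<in> exps. exp_weight \<beta> < Suc n}"
              using \<open>wt (z i) + exp_weight \<beta> \<le> n\<close> \<beta>(1) i(1) by (intro term_monomial_span r) (auto simp: add_mset_exps)
            ultimately have "(gen (z i) * (r * monomial \<beta>) - r * monomial (add_mset i \<beta>))
                + r * monomial (add_mset i \<beta>) \<in> monomial_span {\<beta> \<in> exps. exp_weight \<beta> < Suc n}"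
              by (rule FA.subspace_add[OF subspace_monomial_span])
            then show "z i \<in> V" by (simp add: V_def)
          qed
          then show "gen x * (r * monomial \<beta>) \<in> monomial_span {\<beta> \<in> exps. exp_weight \<beta> < Suc n}" by (simp add: V_def)
        qed
      qed
    qed
  qed
  have "word w \<in> monomial_span {\<beta> \<in> exps. exp_weight \<beta> < n}" if "word_weight w < n" for w
    using words[OF refl, of w] that
      monomial_span_mono[of "{\<beta> \<in> exps. exp_weight \<beta> < Suc (word_weight w)}" "{\<beta> \<in> exps. exp_weight \<beta> < n}"] by fastforce
  then show ?thesis
    unfolding light_span_def by (intro FA.span_minimal subspace_monomial_span) (auto simp: JU_monomial_span)
qed

text \<open>Monomials are compared by weight first, so that lower-order terms of the filtration are lower
  here too, and then by the multiset order, which is linear, well-founded and compatible with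
  multiplication.\<close>

definition lower :: "nat multiset \<Rightarrow> nat multiset set" where
  "lower \<alpha> = {\<beta> \<in> exps. exp_weight \<beta> < exp_weight \<alpha> \<or> exp_weight \<beta> = exp_weight \<alpha> \<and> \<beta> < \<alpha>}"

lemma lower_trans: "\<beta> \<in> lower \<alpha> \<Longrightarrow> lower \<beta> \<subseteq> lower \<alpha>"
  by (auto simp: lower_def)

lemma lower_total: "\<alpha> \<in> exps \<Longrightarrow> \<beta> \<in> exps \<Longrightarrow> \<alpha> \<in> lower \<beta> \<or> \<alpha> = \<beta> \<or> \<beta> \<in> lower \<alpha>"
  by (auto simp: lower_def)

lemma wf_lower: "wf {(\<beta>, \<alpha>). \<beta> \<in> lower \<alpha>}"
proof (rule wf_subset)
  show "wf (inv_image (less_than <*lex*> {(x, y). x < y}) (\<lambda>\<alpha>. (exp_weight \<alpha>, \<alpha>)))"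
    by (intro wf_inv_image wf_lex_prod wf_less_than wf)
qed (auto simp: lower_def)

lemma light_span_monomial_span_lower: "n \<le> exp_weight \<alpha> \<Longrightarrow> light_span n \<subseteq> monomial_span (lower \<alpha>)"
  using light_span_monomial_span[of n] monomial_span_mono[of "{\<beta> \<in> exps. exp_weight \<beta> < n}" "lower \<alpha>"]
  by (fastforce simp: lower_def)

lemma gen_mult_lower:
  assumes i: "i < N" and p: "p \<in> monomial_span (lower \<alpha>)"
  shows "gen (z i) * p \<in> monomial_span (lower (add_mset i \<alpha>))"
proof (rule monomial_span_mult[OF p subspace_monomial_span])
  show "JU \<subseteq> monomial_span (lower (add_mset i \<alpha>))" by (auto simp: JU_monomial_span)
  fix r \<beta> assume r: "r \<in> A L" and \<beta>: "\<beta> \<in> lower \<alpha>"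
  have "add_mset i \<beta> \<in> lower (add_mset i \<alpha>)"
    using \<beta> i by (auto simp: lower_def add_mset_exps)
  then have "r * monomial (add_mset i \<beta>) \<in> monomial_span (lower (add_mset i \<alpha>))"
    by (rule term_monomial_span[OF r])
  moreover have "gen (z i) * (r * monomial \<beta>) - r * monomial (add_mset i \<beta>) \<in> monomial_span (lower (add_mset i \<alpha>))"
    using gen_mult_term[OF i r, of \<beta>] light_span_monomial_span_lower[of "wt (z i) + exp_weight \<beta>" "add_mset i \<alpha>"] \<beta>
    by (auto simp: lower_def)
  ultimately have "r * monomial (add_mset i \<beta>) + (gen (z i) * (r * monomial \<beta>) - r * monomial (add_mset i \<beta>))
      \<in> monomial_span (lower (add_mset i \<alpha>))"
    by (rule FA.subspace_add[OF subspace_monomial_span])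
  then show "gen (z i) * (r * monomial \<beta>) \<in> monomial_span (lower (add_mset i \<alpha>))" by simp
qed

text \<open>The element \<open>p\<close> is \<open>r z\<^sup>\<alpha>\<close> plus lower terms. The coefficient is not determined by \<open>p\<close>, since
  nothing is said about independence of the monomials, and it may be 0.\<close>

definition has_leading_term ::
    "('g free_monoid \<Rightarrow>\<^sub>0 'k) \<Rightarrow> ('g free_monoid \<Rightarrow>\<^sub>0 'k) \<Rightarrow> nat multiset \<Rightarrow> bool" where
  "has_leading_term p r \<alpha> \<longleftrightarrow> r \<in> A L \<and> p - r * monomial \<alpha> \<in> monomial_span (lower \<alpha>)"

lemma has_leading_term_add:
  "has_leading_term p r \<alpha> \<Longrightarrow> has_leading_term q s \<alpha> \<Longrightarrow> has_leading_term (p + q) (r + s) \<alpha>"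
  using FA.subspace_add[OF subspace_monomial_span, of "p - r * monomial \<alpha>" _ "q - s * monomial \<alpha>"]
  by (simp add: has_leading_term_def free_algebra_closed algebra_simps)

lemma has_leading_term_mult:
  assumes "has_leading_term p r \<alpha>" "a \<in> A L"
  shows "has_leading_term (a * p) (a * r) \<alpha>"
  using assms monomial_span_A_mult[of a "p - r * monomial \<alpha>"]
  by (simp add: has_leading_term_def free_algebra_closed algebra_simps)

lemma has_leading_term_gen_mult:
  assumes "has_leading_term p r \<alpha>" "i < N"
  shows "has_leading_term (gen (z i) * p) r (add_mset i \<alpha>)"
proof -
  have r: "r \<in> A L" and p: "p - r * monomial \<alpha> \<in> monomial_span (lower \<alpha>)"
    using assms(1) by (auto simp: has_leading_term_def)
  have "gen (z i) * (p - r * monomial \<alpha>) + (gen (z i) * (r * monomial \<alpha>) - r * monomial (add_mset i \<alpha>))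
      \<in> monomial_span (lower (add_mset i \<alpha>))"
    using gen_mult_term[OF assms(2) r, of \<alpha>] light_span_monomial_span_lower[of "wt (z i) + exp_weight \<alpha>" "add_mset i \<alpha>"]
    by (intro FA.subspace_add[OF subspace_monomial_span] gen_mult_lower p assms(2)) auto
  then show ?thesis using r by (simp add: has_leading_term_def algebra_simps)
qed

lemma has_leading_term_monomial_span:
  "has_leading_term p r \<alpha> \<Longrightarrow> \<alpha> \<in> lower \<beta> \<Longrightarrow> p \<in> monomial_span (lower \<beta>)"
proof -
  assume p: "has_leading_term p r \<alpha>" and \<alpha>: "\<alpha> \<in> lower \<beta>"
  have "(p - r * monomial \<alpha>) + r * monomial \<alpha> \<in> monomial_span (lower \<beta>)"
    using p \<alpha> monomial_span_mono[OF lower_trans[OF \<alpha>]]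
    by (intro FA.subspace_add[OF subspace_monomial_span] term_monomial_span) (auto simp: has_leading_term_def)
  then show ?thesis by simp
qed

lemma has_leading_term_absorb:
  assumes "has_leading_term p r \<alpha>" "q \<in> monomial_span (lower \<alpha>)"
  shows "has_leading_term (p + q) r \<alpha>"
  using assms FA.subspace_add[OF subspace_monomial_span, of "p - r * monomial \<alpha>" _ q]
  by (simp add: has_leading_term_def algebra_simps)

lemma ex_leading_term:
  assumes "p \<in> monomial_span D" "D \<subseteq> exps"
  shows "p \<in> JU \<or> (\<exists>\<alpha>\<in>D. \<exists>r. has_leading_term p r \<alpha>)"
  using assms(1) unfolding monomial_span_def
proof (induction rule: FA.span_induct_alt)
  case base
  then show ?case using JU(2) by simp
next
  case (step c x y)
  from step.IH show ?case
  proof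
    assume y: "y \<in> JU"
    from step.hyps show ?thesis
    proof
      assume "x \<in> JU"
      then show ?thesis using y JU(3)[OF JU(6)] by blast
    next
      assume "x \<in> {word u * monomial \<beta> |u \<beta>. set u \<subseteq> L \<and> \<beta> \<in> D}"
      then obtain u \<beta> where x: "x = word u * monomial \<beta>" "set u \<subseteq> L" "\<beta> \<in> D" by blast
      have "has_leading_term (const c * x + y) (const c * word u) \<beta>"
        using x JU_monomial_span[OF y] by (simp add: has_leading_term_def scale_in_free_algebra
            word_in_free_algebra mult.assoc)
      then show ?thesis using x(3) by blast
    qed
  next
    assume "\<exists>\<alpha>\<in>D. \<exists>r. has_leading_term y r \<alpha>"
    then obtain \<alpha> r where y: "\<alpha> \<in> D" "has_leading_term y r \<alpha>" by blast
    from step.hyps show ?thesis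
    proof
      assume "x \<in> JU"
      then have "has_leading_term (y + const c * x) r \<alpha>"
        using y(2) JU(6) JU_monomial_span by (intro has_leading_term_absorb) auto
      then show ?thesis using y(1) by (auto simp: add.commute)
    next
      assume "x \<in> {word u * monomial \<beta> |u \<beta>. set u \<subseteq> L \<and> \<beta> \<in> D}"
      then obtain u \<beta> where x: "x = word u * monomial \<beta>" "set u \<subseteq> L" "\<beta> \<in> D" by blast
      have cx: "has_leading_term (const c * x) (const c * word u) \<beta>"
        using x FA.subspace_0[OF subspace_monomial_span]
        by (simp add: has_leading_term_def scale_in_free_algebra word_in_free_algebra mult.assoc)
      consider "\<alpha> \<in> lower \<beta>" | "\<alpha> = \<beta>" | "\<beta> \<in> lower \<alpha>"
        using lower_total y(1) x(3) assms(2) by blast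
      then show ?thesis
      proof cases
        case 1
        then show ?thesis
          using has_leading_term_absorb[OF cx has_leading_term_monomial_span[OF y(2)]] x(3) by blast
      next
        case 2
        then show ?thesis using has_leading_term_add[OF cx] y by blast
      next
        case 3
        then show ?thesis
          using has_leading_term_absorb[OF y(2) has_leading_term_monomial_span[OF cx]] y(1)
          by (auto simp: add.commute)
      qed
    qed
  qed
qed

lemma ex_leading_term_UNIV: "p \<in> JU \<or> (\<exists>\<alpha>\<in>exps. \<exists>r. has_leading_term p r \<alpha>)"
proof -
  have "word w \<in> monomial_span exps" for w
    using word_light_span[of w "Suc (word_weight w)"] light_span_monomial_span[of "Suc (word_weight w)"]
      monomial_span_mono[of "{\<beta> \<in> exps. exp_weight \<beta> < Suc (word_weight w)}" exps] by blast
  then have "p \<in> monomial_span exps"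
    by (induction p rule: free_algebra_UNIV_induct)
      (simp_all add: FA.subspace_0[OF subspace_monomial_span] FA.subspace_add[OF subspace_monomial_span]
        FA.subspace_scale[OF subspace_monomial_span])
  then show ?thesis by (rule ex_leading_term) simp
qed

definition leading_ideal :: "('g free_monoid \<Rightarrow>\<^sub>0 'k) set \<Rightarrow> nat multiset \<Rightarrow> ('g free_monoid \<Rightarrow>\<^sub>0 'k) set" where
  "leading_ideal I \<alpha> = {r. \<exists>p\<in>I. has_leading_term p r \<alpha>}"

lemma env_left_ideal_leading_ideal:
  assumes I: "env_left_ideal UNIV I"
  shows "env_left_ideal L (leading_ideal I \<alpha>)"
  unfolding env_left_ideal_def
proof (intro conjI ballI)
  show "J L \<subseteq> leading_ideal I \<alpha>"
  proof
    fix r assume r: "r \<in> J L"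
    have "r * monomial \<alpha> \<in> JU"
      using r enveloping_ideal_mono[OF L lie_subalgebra_UNIV] JU_mult(2) by blast
    then have "r * monomial \<alpha> \<in> I" using I by (auto simp: env_left_ideal_def)
    moreover have "has_leading_term (r * monomial \<alpha>) r \<alpha>"
      using r enveloping_ideal_closed(1)[OF L] FA.subspace_0[OF subspace_monomial_span]
      by (auto simp: has_leading_term_def)
    ultimately show "r \<in> leading_ideal I \<alpha>" by (auto simp: leading_ideal_def)
  qed
  show "leading_ideal I \<alpha> \<subseteq> A L" by (auto simp: leading_ideal_def has_leading_term_def)
  fix p q assume "p \<in> leading_ideal I \<alpha>" "q \<in> leading_ideal I \<alpha>"
  then show "p + q \<in> leading_ideal I \<alpha>"
    using I has_leading_term_add unfolding leading_ideal_def env_left_ideal_def by blast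
next
  fix a p assume a: "a \<in> A L" and "p \<in> leading_ideal I \<alpha>"
  then obtain q where "q \<in> I" "has_leading_term q p \<alpha>" by (auto simp: leading_ideal_def)
  then show "a * p \<in> leading_ideal I \<alpha>"
    using I has_leading_term_mult[OF _ a] free_algebra_UNIV
    unfolding leading_ideal_def env_left_ideal_def by blast
qed

lemma leading_ideal_mono_exponent:
  assumes I: "env_left_ideal UNIV I" and "set_mset \<beta> \<subseteq> {..<N}" "\<alpha> \<subseteq># \<beta>"
  shows "leading_ideal I \<alpha> \<subseteq> leading_ideal I \<beta>"
proof -
  have "leading_ideal I \<alpha> \<subseteq> leading_ideal I (\<alpha> + \<gamma>)" if "set_mset \<gamma> \<subseteq> {..<N}" for \<gamma>
    using that
  proof (induction \<gamma>)
    case (add i \<gamma>)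
    have "leading_ideal I (\<alpha> + \<gamma>) \<subseteq> leading_ideal I (add_mset i (\<alpha> + \<gamma>))"
    proof
      fix r assume "r \<in> leading_ideal I (\<alpha> + \<gamma>)"
      then obtain q where q: "q \<in> I" "has_leading_term q r (\<alpha> + \<gamma>)" by (auto simp: leading_ideal_def)
      have "gen (z i) * q \<in> I"
        using I q(1) free_algebra_UNIV unfolding env_left_ideal_def by blast
      then show "r \<in> leading_ideal I (add_mset i (\<alpha> + \<gamma>))"
        using has_leading_term_gen_mult[OF q(2), of i] add.prems by (auto simp: leading_ideal_def)
    qed
    then show ?case using add by auto
  qed simp
  from this[of "\<beta> - \<alpha>"] show ?thesis
    using assms(2,3) by (auto dest: in_diffD simp: subset_mset.add_diff_inverse)
qed

text \<open>Subtract from an element of the larger ideal one of the smaller ideal with the same leading term,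
  and repeat; the monomial order is well-founded.\<close>

lemma equal_leading_ideals:
  assumes I: "env_left_ideal UNIV I" and I': "env_left_ideal UNIV I'" and sub: "I \<subseteq> I'"
    and eq: "\<And>\<alpha>. \<alpha> \<in> exps \<Longrightarrow> leading_ideal I' \<alpha> \<subseteq> leading_ideal I \<alpha>"
  shows "I' \<subseteq> I"
proof
  have JU_I: "JU \<subseteq> I" using I by (simp add: env_left_ideal_def)
  have diff: "p - q \<in> I'" if "p \<in> I'" "q \<in> I'" for p q
  proof -
    have "const (-1) * q \<in> I'" using I' that(2) free_algebra_UNIV unfolding env_left_ideal_def by blast
    then have "p + const (-1) * q \<in> I'" using I' that(1) unfolding env_left_ideal_def by blast
    then show ?thesis by (simp add: const_uminus)
  qed
  have *: "p \<in> I" if "\<alpha> \<in> exps" "p \<in> I'" "has_leading_term p r \<alpha>" for p r \<alpha>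
    using that
  proof (induction \<alpha> arbitrary: p r rule: wf_induct_rule[OF wf_lower])
    case (1 \<alpha>)
    obtain q where q: "q \<in> I" "has_leading_term q r \<alpha>"
      using 1(2-4) eq by (fastforce simp: leading_ideal_def)
    have "p - q \<in> I'" using diff 1(3) q(1) sub by blast
    have "(p - r * monomial \<alpha>) - (q - r * monomial \<alpha>) \<in> monomial_span (lower \<alpha>)"
      by (rule FA.subspace_diff[OF subspace_monomial_span])
        (use 1(4) q(2) in \<open>simp_all add: has_leading_term_def\<close>)
    then have "p - q \<in> monomial_span (lower \<alpha>)" by simp
    moreover have "lower \<alpha> \<subseteq> exps" by (auto simp: lower_def)
    ultimately have "p - q \<in> JU \<or> (\<exists>\<beta>\<in>lower \<alpha>. \<exists>s. has_leading_term (p - q) s \<beta>)"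
      by (rule ex_leading_term)
    then have "p - q \<in> I"
    proof
      assume "\<exists>\<beta>\<in>lower \<alpha>. \<exists>s. has_leading_term (p - q) s \<beta>"
      then obtain \<beta> s where "\<beta> \<in> lower \<alpha>" "has_leading_term (p - q) s \<beta>" by blast
      then show ?thesis using 1(1)[of \<beta> "p - q" s] \<open>p - q \<in> I'\<close> by (simp add: lower_def)
    qed (use JU_I in blast)
    then have "(p - q) + q \<in> I" using I q(1) unfolding env_left_ideal_def by blast
    then show ?case by simp
  qed
  fix p assume "p \<in> I'"
  then show "p \<in> I" using ex_leading_term_UNIV[of p] * JU_I by blast
qed

text \<open>Hilbert's basis theorem for the filtered algebra: an ascending chain of left ideals has an ascending
  chain of families of leading ideals, which becomes stationary for all exponents at once.\<close>

theorem noetherian_enveloping_UNIV: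
  assumes noeth: "noetherian (enveloping_algebra scale bracket L)"
  shows "noetherian (enveloping_algebra scale bracket UNIV)"
  unfolding noetherian_enveloping_algebra_iff[OF lie_subalgebra_UNIV]
proof (intro allI impI, elim conjE)
  fix I :: "nat \<Rightarrow> ('g free_monoid \<Rightarrow>\<^sub>0 'k) set"
  assume "\<forall>n. env_left_ideal UNIV (I n)" "\<forall>n. I n \<subseteq> I (Suc n)"
  then have I: "\<And>n. env_left_ideal UNIV (I n)" "\<And>n. I n \<subseteq> I (Suc n)" by auto
  have "\<exists>M. \<forall>n\<ge>M. \<forall>\<alpha>. set_mset \<alpha> \<subseteq> {..<N} \<longrightarrow> leading_ideal (I n) \<alpha> = leading_ideal (I M) \<alpha>"
  proof (rule stabilize_multiset_family[where P = "env_left_ideal L"])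
    show "leading_ideal (I n) \<alpha> \<subseteq> leading_ideal (I (Suc n)) \<alpha>" for n \<alpha>
      using I(2) by (auto simp: leading_ideal_def)
    show "leading_ideal (I n) \<alpha> \<subseteq> leading_ideal (I n) \<beta>"
      if "set_mset \<beta> \<subseteq> {..<N}" "\<alpha> \<subseteq># \<beta>" for n \<alpha> \<beta>
      by (rule leading_ideal_mono_exponent[OF I(1) that])
    show "env_left_ideal L (leading_ideal (I n) \<alpha>)" for n \<alpha>
      by (rule env_left_ideal_leading_ideal[OF I(1)])
    show "\<exists>M. \<forall>j\<ge>M. K j = K M"
      if "\<And>j. env_left_ideal L (K j)" "\<And>j. K j \<subseteq> K (Suc j)" for K :: "nat \<Rightarrow> _ set"
      using noeth[unfolded noetherian_enveloping_algebra_iff[OF L], rule_format, of K] that by blast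
  qed
  then obtain M where M: "\<And>n \<alpha>. n \<ge> M \<Longrightarrow> \<alpha> \<in> exps \<Longrightarrow> leading_ideal (I n) \<alpha> = leading_ideal (I M) \<alpha>"
    unfolding exps_def by blast
  have "I n = I M" if "n \<ge> M" for n
  proof
    show sub: "I M \<subseteq> I n" by (rule lift_Suc_mono_le[of I, OF I(2) that])
    show "I n \<subseteq> I M" 
      by (rule equal_leading_ideals[OF I(1) I(1) sub]) (rule equalityD1[OF M[OF that]])
  qed
  then show "\<exists>N. \<forall>n\<ge>N. I n = I N" by blast
qed

end

section \<open>Subalgebras of finite codimension\<close>

context lie_algebra
begin

text \<open>Codimension of \<open>W\<close> in a subspace \<open>U\<close> rather than in the whole space, phrased by spanning sets.\<close>

definition finite_relative_codimension :: "'g set \<Rightarrow> 'g set \<Rightarrow> bool" where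
  "finite_relative_codimension W U \<longleftrightarrow> (\<exists>S\<subseteq>U. finite S \<and> U \<subseteq> span (W \<union> S))"

lemma finite_relative_codimension_trans:
  assumes "finite_relative_codimension W V" "finite_relative_codimension V U" "V \<subseteq> U"
  shows "finite_relative_codimension W U"
proof -
  obtain S where S: "S \<subseteq> V" "finite S" "V \<subseteq> span (W \<union> S)"
    using assms(1) by (auto simp: finite_relative_codimension_def)
  obtain T where T: "T \<subseteq> U" "finite T" "U \<subseteq> span (V \<union> T)"
    using assms(2) by (auto simp: finite_relative_codimension_def)
  have "V \<union> T \<subseteq> span (W \<union> (S \<union> T))"
    using S(3) span_mono[of "W \<union> S" "W \<union> (S \<union> T)"] span_superset[of "W \<union> (S \<union> T)"] by auto
  then have "U \<subseteq> span (W \<union> (S \<union> T))"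
    using T(3) span_minimal[OF _ subspace_span] by blast
  then show ?thesis
    unfolding finite_relative_codimension_def using S T assms(3) by (intro exI[of _ "S \<union> T"]) auto
qed

text \<open>The preimage of a subspace under a linear map has at most its codimension. Adding the elements of
  \<open>T\<close> to \<open>W\<close> one at a time, the preimage grows by at most one dimension in each step.\<close>

lemma finite_relative_codimension_vimage:
  assumes add: "\<And>x y. f (x + y) = f x + f y" and sc: "\<And>c x. f (scale c x) = scale c (f x)"
    and U: "subspace U" and "finite T"
    and "subspace W" and "\<And>x. x \<in> U \<Longrightarrow> f x \<in> span (W \<union> T)"
  shows "finite_relative_codimension {x \<in> U. f x \<in> W} U"
  using assms(4-)
proof (induction T arbitrary: W rule: finite_induct)
  case empty
  have "f x \<in> W" if "x \<in> U" for x
    using empty(2)[OF that] span_minimal[OF order_refl empty(1)] by auto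
  then have "{x \<in> U. f x \<in> W} = U" by auto
  then show ?case
    using span_superset[of U] by (auto simp: finite_relative_codimension_def intro!: exI[of _ "{}"])
next
  case (insert t T)
  have diff: "f (x - y) = f x - f y" for x y
    using add[of "x - y" y] by simp
  define W' where "W' = span (insert t W)"
  have W': "subspace W'" "insert t W \<subseteq> W'" by (auto simp: W'_def span_superset)
  let ?V = "{x \<in> U. f x \<in> W'}" and ?Z = "{x \<in> U. f x \<in> W}"
  have "span (W \<union> insert t T) \<subseteq> span (W' \<union> T)"
    using W'(2) by (intro span_mono) auto
  then have "finite_relative_codimension ?V U"
    using insert.prems(2) by (intro insert.IH W'(1)) blast
  moreover have "finite_relative_codimension ?Z ?V"
  proof (cases "?V \<subseteq> ?Z")
    case True
    then show ?thesis
      using span_superset[of ?Z] by (auto simp: finite_relative_codimension_def intro!: exI[of _ "{}"])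
  next
    case False
    then obtain x where x: "x \<in> U" "f x \<in> W'" "f x \<notin> W" by blast
    have W_span: "span W = W" using insert.prems(1) by simp
    obtain k where k: "f x - scale k t \<in> W"
      using x(2) by (auto simp: W'_def span_insert W_span)
    with x(3) have "k \<noteq> 0" by auto
    have "y \<in> span (?Z \<union> {x})" if y: "y \<in> ?V" for y
    proof -
      obtain l where l: "f y - scale l t \<in> W"
        using y by (auto simp: W'_def span_insert W_span)
      have "(f y - scale l t) - scale (l / k) (f x - scale k t) \<in> W"
        by (rule subspace_diff[OF insert.prems(1) l subspace_scale[OF insert.prems(1) k]])
      also have "(f y - scale l t) - scale (l / k) (f x - scale k t) = f (y - scale (l / k) x)"
        using \<open>k \<noteq> 0\<close> by (simp add: diff sc scale_right_diff_distrib)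
      finally have "y - scale (l / k) x \<in> ?Z"
        using x(1) y U by (auto intro: subspace_diff subspace_scale)
      then have "(y - scale (l / k) x) + scale (l / k) x \<in> span (?Z \<union> {x})"
        by (intro span_add span_scale span_base) auto
      then show ?thesis by simp
    qed
    then show ?thesis
      unfolding finite_relative_codimension_def using x by (intro exI[of _ "{x}"]) blast
  qed
  moreover have "?V \<subseteq> U" by blast
  ultimately show ?case by (metis finite_relative_codimension_trans)
qed

lemma finite_codimension_imp_finite_relative_codimension:
  assumes W: "subspace W" and fin: "finite_codimension scale W"
  shows "finite_relative_codimension W UNIV"
proof -
  obtain S where S: "S \<subseteq> quotient_space W" "finite S" "quotient_span scale W S = quotient_space W"
    using fin by (auto simp: finite_codimension_def)
  then obtain T where T: "finite T" "S = coset W ` T"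
    unfolding quotient_space_def by (metis finite_subset_image)
  let ?Q = "coset W ` span (W \<union> T)"
  have "quotient_subspace scale W ?Q"
    unfolding quotient_subspace_def
    by (auto simp: quotient_space_def quotient_add_coset[OF W] quotient_scale_coset[OF W]
        span_zero intro!: imageI span_add span_scale)
  moreover have "S \<subseteq> ?Q" using T(2) span_superset[of "W \<union> T"] by auto
  ultimately have "quotient_space W \<subseteq> ?Q"
    using S(3) unfolding quotient_span_def by blast
  have "x \<in> span (W \<union> T)" for x
  proof -
    obtain y where y: "y \<in> span (W \<union> T)" "coset W x = coset W y"
      using \<open>quotient_space W \<subseteq> ?Q\<close> by (auto simp: quotient_space_def)
    have "x \<in> coset W x" using subspace_0[OF W] by (auto simp: coset_def intro!: exI[of _ 0])
    then have "x \<in> coset W y" using y(2) by simp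
    then obtain w where "w \<in> W" "x = y + w" by (auto simp: coset_def)
    then show ?thesis using y(1) by (auto intro: span_add span_base)
  qed
  then show ?thesis unfolding finite_relative_codimension_def using T(1) by auto
qed

text \<open>For a subalgebra \<open>L\<close> this is the kernel of the action of \<open>L\<close> on the quotient by \<open>L\<close>.\<close>

definition stabilizer :: "'g set \<Rightarrow> 'g set" where
  "stabilizer L = {x \<in> L. \<forall>y. bracket x y \<in> L}"

context
  fixes L :: "'g set"
  assumes liesub_L: "liesub L"
begin

lemma subspace_L: "subspace L" and bracket_L: "x \<in> L \<Longrightarrow> y \<in> L \<Longrightarrow> bracket x y \<in> L"
  using liesub_L by (auto simp: lie_subalgebra_def)

lemma bracket_L_swap: "bracket x y \<in> L \<longleftrightarrow> bracket y x \<in> L"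
  using subspace_neg[OF subspace_L] bracket_antisym by metis

lemma bracket_stabilizer:
  assumes x: "x \<in> stabilizer L" and u: "u \<in> L"
  shows "bracket u x \<in> stabilizer L"
proof -
  have "bracket (bracket u x) y \<in> L" for y
  proof -
    have "bracket u (bracket x y) \<in> L" "bracket x (bracket y u) \<in> L"
      using x u bracket_L by (auto simp: stabilizer_def)
    then have "- (bracket u (bracket x y) + bracket x (bracket y u)) \<in> L"
      using subspace_neg[OF subspace_L] subspace_add[OF subspace_L] by blast
    also have "- (bracket u (bracket x y) + bracket x (bracket y u)) = bracket y (bracket u x)"
      using jacobi[of u x y] by (metis minus_unique)
    finally show ?thesis by (simp add: bracket_L_swap)
  qed
  then show ?thesis using x u bracket_L by (simp add: stabilizer_def)
qed

lemma bracket_stabilizer': "x \<in> stabilizer L \<Longrightarrow> u \<in> L \<Longrightarrow> bracket x u \<in> stabilizer L"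
proof -
  assume x: "x \<in> stabilizer L" and u: "u \<in> L"
  have "bracket x u \<in> L" using x u bracket_L by (simp add: stabilizer_def)
  moreover have "bracket (bracket x u) y \<in> L" for y
  proof -
    have "bracket (bracket x u) y = - bracket (bracket u x) y"
      using bracket_scale_left[of "-1" "bracket u x" y] by (simp add: bracket_antisym[of x u])
    then show ?thesis
      using bracket_stabilizer[OF x u] subspace_neg[OF subspace_L] by (auto simp: stabilizer_def)
  qed
  ultimately show ?thesis by (simp add: stabilizer_def)
qed

lemma liesub_stabilizer: "liesub (stabilizer L)"
proof -
  have "subspace (stabilizer L)"
    using subspace_0[OF subspace_L] subspace_add[OF subspace_L] subspace_scale[OF subspace_L]
    by (auto simp: subspace_def stabilizer_def bracket_add_left bracket_scale_left)
  then show ?thesis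
    using bracket_stabilizer by (simp add: lie_subalgebra_def) (simp add: stabilizer_def)
qed

text \<open>The condition that \<open>[x, y]\<close> lies in \<open>L\<close> needs to be imposed only for the finitely many \<open>y\<close> that
  span everything together with \<open>L\<close>, and each such condition cuts out a subspace of finite codimension.\<close>

lemma finite_relative_codimension_stabilizer:
  assumes fin: "finite_relative_codimension L UNIV"
  shows "finite_relative_codimension (stabilizer L) L"
proof -
  obtain T where T: "finite T" "span (L \<union> T) = UNIV"
    using fin by (auto simp: finite_relative_codimension_def)
  have "finite_relative_codimension {x \<in> L. \<forall>y\<in>S. bracket x y \<in> L} L" if "finite S" for S
    using that
  proof (induction S)
    case empty
    show ?case
      using span_superset[of L] by (auto simp: finite_relative_codimension_def intro!: exI[of _ "{}"])
  next
    case (insert s S)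
    let ?U = "{x \<in> L. \<forall>y\<in>S. bracket x y \<in> L}"
    have "subspace ?U"
      using subspace_0[OF subspace_L] subspace_add[OF subspace_L] subspace_scale[OF subspace_L]
      by (auto simp: subspace_def bracket_add_left bracket_scale_left)
    then have "finite_relative_codimension {x \<in> ?U. bracket x s \<in> L} ?U"
      by (rule finite_relative_codimension_vimage[OF bracket_add_left bracket_scale_left _ T(1) subspace_L])
        (simp add: T(2))
    from finite_relative_codimension_trans[OF this insert.IH]
    have "finite_relative_codimension {x \<in> ?U. bracket x s \<in> L} L" by auto
    moreover have "{x \<in> ?U. bracket x s \<in> L} = {x \<in> L. \<forall>y\<in>insert s S. bracket x y \<in> L}" by auto
    ultimately show ?case by simp
  qed
  from this[OF T(1)] have "finite_relative_codimension {x \<in> L. \<forall>y\<in>T. bracket x y \<in> L} L" .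
  moreover have "{x \<in> L. \<forall>y\<in>T. bracket x y \<in> L} = stabilizer L"
  proof -
    have "bracket x y \<in> L" if x: "x \<in> L" "\<forall>y\<in>T. bracket x y \<in> L" for x y
    proof -
      have "subspace {y. bracket x y \<in> L}"
        using subspace_0[OF subspace_L] subspace_add[OF subspace_L] subspace_scale[OF subspace_L]
        by (auto simp: subspace_def bracket_add_right bracket_scale_right)
      moreover have "L \<union> T \<subseteq> {y. bracket x y \<in> L}" using x bracket_L by auto
      ultimately have "span (L \<union> T) \<subseteq> {y. bracket x y \<in> L}" by (intro span_minimal)
      then show ?thesis using T(2) by auto
    qed
    then show ?thesis by (auto simp: stabilizer_def)
  qed
  ultimately show ?thesis by simp
qed

text \<open>With \<open>K\<close> the stabilizer, elements outside \<open>L\<close> need a weight larger than those of \<open>L\<close>: bracketing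
  with \<open>K\<close>, of weight 0, takes them into \<open>L\<close>, and the bracket has to be lighter.\<close>

theorem noetherian_enveloping_finite_relative_codimension:
  assumes fin: "finite_relative_codimension L UNIV" and noeth: "noetherian (enveloping_algebra scale bracket L)"
  shows "noetherian (enveloping_algebra scale bracket UNIV)"
proof -
  let ?K = "stabilizer L"
  have KL: "?K \<subseteq> L" by (auto simp: stabilizer_def)
  obtain S where S: "S \<subseteq> L" "finite S" "L \<subseteq> span (?K \<union> S)"
    using finite_relative_codimension_stabilizer[OF fin] by (auto simp: finite_relative_codimension_def)
  obtain T where T: "finite T" "span (L \<union> T) = UNIV"
    using fin by (auto simp: finite_relative_codimension_def)
  have "finite ((S \<union> T) - ?K)" using S(2) T(1) by simp
  then obtain N and z :: "nat \<Rightarrow> 'g" where z: "(S \<union> T) - ?K = z ` {i. i < N}"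
    using finite_imp_nat_seg_image_inj_on by blast
  define wt :: "'g \<Rightarrow> nat" where "wt x = (if x \<in> ?K then 0 else if x \<in> L then 1 else 2)" for x
  interpret weighted_generators scale bracket ?K wt z N
  proof
    show "liesub ?K" by (rule liesub_stabilizer)
    show "wt x = 0 \<longleftrightarrow> x \<in> ?K" for x by (simp add: wt_def)
    show "wt (bracket x y) < wt x + wt y" if "wt x + wt y > 0" for x y
    proof -
      have 1: "wt v \<le> 1" if "v \<in> L" for v using that by (simp add: wt_def)
      have 2: "wt v \<le> 2" for v by (simp add: wt_def)
      consider "x \<in> ?K" "y \<in> ?K" | "x \<in> ?K" "y \<in> L - ?K" | "x \<in> ?K" "y \<notin> L"
        | "x \<in> L - ?K" "y \<in> ?K" | "x \<notin> L" "y \<in> ?K"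
        | "x \<in> L - ?K" "y \<in> L - ?K" | "x \<in> L - ?K" "y \<notin> L" | "x \<notin> L" "y \<in> L - ?K"
        | "x \<notin> L" "y \<notin> L" by blast
      then show ?thesis
      proof cases
        case 1
        then show ?thesis using that by (simp add: wt_def)
      next
        case 2
        then show ?thesis using bracket_stabilizer'[of x y] by (simp add: wt_def)
      next
        case 3
        then have "bracket x y \<in> L" by (simp add: stabilizer_def)
        with 3 1[OF this] KL show ?thesis by (auto simp: wt_def)
      next
        case 4
        then show ?thesis using bracket_stabilizer[of y x] by (simp add: wt_def)
      next
        case 5
        then have "bracket x y \<in> L" by (simp add: bracket_L_swap[of x] stabilizer_def)
        with 5 1[OF this] KL show ?thesis by (auto simp: wt_def)
      next
        case 6
        then show ?thesis using 1[OF bracket_L[of x y]] by (simp add: wt_def)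
      next
        case 7
        then show ?thesis using 2[of "bracket x y"] KL by (auto simp: wt_def)
      next
        case 8
        then show ?thesis using 2[of "bracket x y"] KL by (auto simp: wt_def)
      next
        case 9
        then show ?thesis using 2[of "bracket x y"] KL by (auto simp: wt_def)
      qed
    qed
    show "wt (z i) > 0" if "i < N" for i
      using that z by (auto simp: wt_def)
    show "x \<in> V" if V: "subspace V" "?K \<subseteq> V" "\<And>i. i < N \<Longrightarrow> wt (z i) \<le> wt x \<Longrightarrow> z i \<in> V" for x V
    proof -
      have gens: "y \<in> V" if "y \<in> S \<union> T" "wt y \<le> wt x" for y
        using that V z by (cases "y \<in> ?K") (blast, metis (no_types, lifting) DiffI imageE mem_Collect_eq)
      have LV: "L \<subseteq> V" if "wt x \<ge> 1"
      proof -
        have "wt y \<le> 1" if "y \<in> S" for y using that S(1) by (auto simp: wt_def)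
        then have "?K \<union> S \<subseteq> V" using gens that V(2) by fastforce
        then show ?thesis using S(3) span_minimal[OF _ V(1)] by blast
      qed
      show ?thesis
      proof (cases "x \<in> L")
        case True
        then show ?thesis using LV V(2) by (cases "x \<in> ?K") (auto simp: wt_def)
      next
        case False
        then have "wt x = 2" using KL by (auto simp: wt_def)
        then have "L \<union> T \<subseteq> V" using LV gens by (auto simp: wt_def)
        then show ?thesis using T(2) span_minimal[OF _ V(1)] by blast
      qed
    qed
  qed
  have "noetherian (enveloping_algebra scale bracket ?K)"
    by (rule noetherian_enveloping_subalgebra[OF liesub_stabilizer liesub_L KL noeth])
  then show ?thesis by (rule noetherian_enveloping_UNIV)
qed

end

end

theorem proposition0p1:
  fixes scale :: "'k::field_char_0 \<Rightarrow> 'g::ab_group_add \<Rightarrow> 'g"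
    and bracket :: "'g \<Rightarrow> 'g \<Rightarrow> 'g"
    and \<hh> :: "'g set"
  assumes "lie_algebra scale bracket"
    and "lie_subalgebra scale bracket \<hh>"
    and "finite_codimension scale \<hh>"
  shows "noetherian (enveloping_algebra scale bracket \<hh>) \<longleftrightarrow>
         noetherian (enveloping_algebra scale bracket UNIV)"
proof -
  interpret lie_algebra scale bracket by fact
  have "finite_relative_codimension \<hh> UNIV"
    using assms(2,3) by (intro finite_codimension_imp_finite_relative_codimension) (auto simp: lie_subalgebra_def)
  then show ?thesis
    using noetherian_enveloping_finite_relative_codimension[OF assms(2)]
      noetherian_enveloping_subalgebra[OF assms(2) lie_subalgebra_UNIV subset_UNIV] by blast
qed

end
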